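(* If $G$ is an almost bipartite graph, then the ideal $I_{G\to\Lambda}$ has a quadratic square-free Gröbner basis.
   Context: Graphs are finite and undirected without multiple edges; loops are allowed in general. A graph is almost bipartite if it becomes bipartite after deleting some vertex. $\mathrm{Hom}(G,H)$ is the set of graph homomorphisms, i.e. maps $\phi:V(G)\to V(H)$ with $\phi(u)\phi(v)\in E(H)$ whenever $uv\in E(G)$. Fix a field $\mathbf{k}$. For $e\in E(G)$ let $G[e]$ be the subgraph consisting only of $e$ and its endpoint(s). Put $R_{G\to H}=\mathbf{k}[r_\phi : \phi\in\mathrm{Hom}(G,H)]$ and $S_{G\to H}=\mathbf{k}[s_\psi : e\in E(G),\ \psi\in \mathrm{Hom}(G[e],H)]$. Let $\Phi_{G\to H}:R_{G\to H}\to S_{G\to H}$ be the $\mathbf{k}$-algebra map with $\Phi(r_\phi)=\prod_{e\in E(G)} s_{\phi|_e}$, and $I_{G\to H}=\ker\Phi_{G\to H}$. $\Lambda$ is the graph with two vertices joined by an edge and with a loop at exactly one of the two vertices (so $\mathrm{Hom}(G,\Lambda)$ corresponds to the independent sets of $G$, as preimages of the unlooped vertex).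
   Formalization: "Quadratic" is read as homogeneous of degree 2 when G has no isolated vertices, and as degree at most 2 otherwise, since an isolated vertex forces linear elements such as r_φ − r_φ' (or r_φ − 1 if G has no edges) into the ideal. *)

theory Defs
  imports "HOL-Library.Poly_Mapping" "HOL-Library.FuncSet"
begin

(* Finite undirected graphs without multiple edges: an edge is the set of its endpoints,
   so a loop at v is the singleton {v}. *)
record 'v ugraph =
  verts :: "'v set"
  edges :: "'v set set"

definition graph :: "'v ugraph \<Rightarrow> bool" where
  "graph G \<longleftrightarrow> finite (verts G) \<and>
     (\<forall>e\<in>edges G. e \<subseteq> verts G \<and> (card e = 1 \<or> card e = 2))"

definition delete_vertex :: "'v ugraph \<Rightarrow> 'v \<Rightarrow> 'v ugraph" where
  "delete_vertex G v = \<lparr>verts = verts G - {v}, edges = {e \<in> edges G. v \<notin> e}\<rparr>"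

definition bipartite :: "'v ugraph \<Rightarrow> bool" where
  "bipartite G \<longleftrightarrow> (\<exists>A B. A \<union> B = verts G \<and> A \<inter> B = {} \<and>
     (\<forall>e\<in>edges G. \<exists>a\<in>A. \<exists>b\<in>B. e = {a, b}))"

definition almost_bipartite :: "'v ugraph \<Rightarrow> bool" where
  "almost_bipartite G \<longleftrightarrow> (\<exists>v\<in>verts G. bipartite (delete_vertex G v))"

definition has_isolated_vertex :: "'v ugraph \<Rightarrow> bool" where
  "has_isolated_vertex G \<longleftrightarrow> (\<exists>v\<in>verts G. \<forall>e\<in>edges G. v \<notin> e)"

(* Homomorphisms are extensional functions (undefined outside the vertex set), so that
   distinct elements of Hom G H are distinct maps on the vertices. *)
definition Hom :: "'v ugraph \<Rightarrow> 'h ugraph \<Rightarrow> ('v \<Rightarrow> 'h) set" where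
  "Hom G H = {\<phi> \<in> verts G \<rightarrow>\<^sub>E verts H. \<forall>u v. {u, v} \<in> edges G \<longrightarrow> {\<phi> u, \<phi> v} \<in> edges H}"

definition edge_subgraph :: "'v set \<Rightarrow> 'v ugraph" where
  "edge_subgraph e = \<lparr>verts = e, edges = {e}\<rparr>"

(* True is the unlooped vertex, so the preimage of True is the independent set. *)
definition Lambda_graph :: "bool ugraph" where
  "Lambda_graph = \<lparr>verts = {False, True}, edges = {{False}, {False, True}}\<rparr>"


(* A monomial is its exponent vector. *)
type_synonym 'x monom = "'x \<Rightarrow>\<^sub>0 nat"
type_synonym ('x, 'k) mpoly = "'x monom \<Rightarrow>\<^sub>0 'k"

definition monoms :: "'x set \<Rightarrow> 'x monom set" where
  "monoms X = {m. Poly_Mapping.keys m \<subseteq> X}"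

definition polys :: "'x set \<Rightarrow> ('x, 'k::zero) mpoly set" where
  "polys X = {p. Poly_Mapping.keys p \<subseteq> monoms X}"

definition poly_var :: "'x \<Rightarrow> ('x, 'k::zero_neq_one) mpoly" where
  "poly_var x = Poly_Mapping.single (Poly_Mapping.single x 1) 1"

definition monom_poly :: "'x monom \<Rightarrow> ('x, 'k::zero_neq_one) mpoly" where
  "monom_poly m = Poly_Mapping.single m 1"

definition monom_deg :: "'x monom \<Rightarrow> nat" where
  "monom_deg m = (\<Sum>x\<in>Poly_Mapping.keys m. Poly_Mapping.lookup m x)"

definition squarefree_monom :: "'x monom \<Rightarrow> bool" where
  "squarefree_monom m \<longleftrightarrow> (\<forall>x. Poly_Mapping.lookup m x \<le> 1)"

(* The k-algebra map sending each variable x to f x. *)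
definition subst_poly ::
  "('x \<Rightarrow> ('y, 'k::comm_ring_1) mpoly) \<Rightarrow> ('x, 'k) mpoly \<Rightarrow> ('y, 'k) mpoly" where
  "subst_poly f p = (\<Sum>m\<in>Poly_Mapping.keys p.
     Poly_Mapping.single 0 (Poly_Mapping.lookup p m) *
       (\<Prod>x\<in>Poly_Mapping.keys m. f x ^ Poly_Mapping.lookup m x))"

definition poly_ideal ::
  "'x set \<Rightarrow> ('x, 'k::comm_ring_1) mpoly set \<Rightarrow> ('x, 'k) mpoly set" where
  "poly_ideal X A = {(\<Sum>a\<in>F. q a * a) | F q. finite F \<and> F \<subseteq> A \<and> (\<forall>a\<in>F. q a \<in> polys X)}"


(* Only orders for finite X are needed; they are automatically well-orders. *)
definition monomial_order :: "'x set \<Rightarrow> 'x monom rel \<Rightarrow> bool" where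
  "monomial_order X r \<longleftrightarrow> linear_order_on (monoms X) r \<and>
     (\<forall>m\<in>monoms X. (0, m) \<in> r) \<and>
     (\<forall>m n k. (m, n) \<in> r \<longrightarrow> k \<in> monoms X \<longrightarrow> (m + k, n + k) \<in> r)"

(* Meaningful for nonzero polynomials only. *)
definition lead_monom :: "'x monom rel \<Rightarrow> ('x, 'k::zero) mpoly \<Rightarrow> 'x monom" where
  "lead_monom r p =
     (THE m. m \<in> Poly_Mapping.keys p \<and> (\<forall>n\<in>Poly_Mapping.keys p. (n, m) \<in> r))"

definition lead_ideal ::
  "'x set \<Rightarrow> 'x monom rel \<Rightarrow> ('x, 'k::comm_ring_1) mpoly set \<Rightarrow> ('x, 'k) mpoly set" where
  "lead_ideal X r A = poly_ideal X ((\<lambda>f. monom_poly (lead_monom r f)) ` (A - {0}))"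

definition groebner_basis ::
  "'x set \<Rightarrow> 'x monom rel \<Rightarrow> ('x, 'k::field) mpoly set \<Rightarrow> ('x, 'k) mpoly set \<Rightarrow> bool" where
  "groebner_basis X r I B \<longleftrightarrow>
     finite B \<and> B \<subseteq> I \<and> 0 \<notin> B \<and> lead_ideal X r B = lead_ideal X r I"


definition S_vars :: "'v ugraph \<Rightarrow> 'h ugraph \<Rightarrow> ('v set \<times> ('v \<Rightarrow> 'h)) set" where
  "S_vars G H = (SIGMA e:edges G. Hom (edge_subgraph e) H)"

definition Phi ::
  "'v ugraph \<Rightarrow> ('v \<Rightarrow> 'h, 'k::field) mpoly \<Rightarrow> ('v set \<times> ('v \<Rightarrow> 'h), 'k) mpoly" where
  "Phi G = subst_poly (\<lambda>\<phi>. \<Prod>e\<in>edges G. poly_var (e, restrict \<phi> e))"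

(* Phi does not mention its codomain polys (S_vars G H); the variables it uses lie there. *)
lemma restrict_in_S_vars:
  assumes "graph G" "\<phi> \<in> Hom G H" "e \<in> edges G"
  shows "(e, restrict \<phi> e) \<in> S_vars G H"
  using assms by (fastforce simp: S_vars_def Hom_def edge_subgraph_def graph_def)

definition hom_ideal ::
  "'v ugraph \<Rightarrow> 'h ugraph \<Rightarrow> ('v \<Rightarrow> 'h, 'k::field) mpoly set" where
  "hom_ideal G H = {p \<in> polys (Hom G H). Phi G p = 0}"

(* If v is isolated and homomorphisms phi, phi' differ only at v, then r_phi - r_phi' lies in
   the kernel, and if G is edgeless so does r_phi - 1; every Groebner basis then contains
   elements with a linear initial term. Hence degree at most 2 in general, and homogeneous
   of degree 2 when G has no isolated vertices. *)
definition quadratic_basis :: "'v ugraph \<Rightarrow> ('x, 'k::zero) mpoly set \<Rightarrow> bool" where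
  "quadratic_basis G B \<longleftrightarrow>
     (\<forall>g\<in>B. \<forall>m\<in>Poly_Mapping.keys g. monom_deg m \<le> 2) \<and>
     (\<not> has_isolated_vertex G \<longrightarrow> (\<forall>g\<in>B. \<forall>m\<in>Poly_Mapping.keys g. monom_deg m = 2))"

end

theory Submission
  imports Defs
begin

text \<open>Let \<open>A\<close>, \<open>B\<close> be the sides of \<open>G - v\<close>, and let the level of an independent set be the number of
  its vertices in \<open>A\<close> minus the number in \<open>B\<close>, minus a large constant if it contains \<open>v\<close>.
  Exchanging vertices between two independent sets, if it yields independent sets again, changes
  neither the image of their product nor the sum of their levels. A monomial order that favours a large sum of
  squared levels makes every exchange that lowers one set of a pair below both old ones a
  quadratic reduction; isolated vertices are penalised so heavily that they are removed first, by
  linear reductions. In an irreducible monomial the sets avoiding \<open>v\<close> form a chain of the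
  distributive lattice of independent sets, and so do those containing \<open>v\<close>, so the monomial is
  determined by the vertex counts on both parts. Two irreducible monomials with the same
  image have the same counts, since at a discrepancy one of them would admit another exchange between
  a set containing \<open>v\<close> and one avoiding it. Hence every fibre contains one irreducible monomial.\<close>

section \<open>Weights of monomials\<close>

text \<open>Degree, order, exponents of the image monomial and vertex counts are all weights for
  suitable \<open>w\<close>, so additivity is shown once.\<close>

definition weight :: "('x \<Rightarrow> nat) \<Rightarrow> 'x monom \<Rightarrow> nat" where
  "weight w m = (\<Sum>x\<in>Poly_Mapping.keys m. Poly_Mapping.lookup m x * w x)"

lemma weight_eq_sum:
  assumes "finite S" "Poly_Mapping.keys m \<subseteq> S"
  shows "weight w m = (\<Sum>x\<in>S. Poly_Mapping.lookup m x * w x)"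
  unfolding weight_def by (rule sum.mono_neutral_left) (use assms in \<open>auto simp: in_keys_iff\<close>)

lemma weight_0 [simp]: "weight w 0 = 0"
  by (simp add: weight_def)

lemma weight_add [simp]: "weight w (m + n) = weight w m + weight w n"
proof -
  let ?S = "Poly_Mapping.keys m \<union> Poly_Mapping.keys n"
  have "weight w l = (\<Sum>x\<in>?S. Poly_Mapping.lookup l x * w x)" if "Poly_Mapping.keys l \<subseteq> ?S" for l
    using that by (intro weight_eq_sum) auto
  then show ?thesis
    using Poly_Mapping.keys_add[of m n] by (simp add: lookup_add sum.distrib distrib_right)
qed

lemma weight_single [simp]: "weight w (Poly_Mapping.single x k) = k * w x"
  by (simp add: weight_def)

lemma weight_cong: "(\<And>x. x \<in> Poly_Mapping.keys m \<Longrightarrow> w x = w' x) \<Longrightarrow> weight w m = weight w' m"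
  by (simp add: weight_def)

lemma weight_add_fun: "weight (\<lambda>x. w x + w' x) m = weight w m + weight w' m"
  by (simp add: weight_def sum.distrib distrib_left)

lemma weight_mono: "(\<And>x. x \<in> Poly_Mapping.keys m \<Longrightarrow> w x \<le> w' x) \<Longrightarrow> weight w m \<le> weight w' m"
  by (simp add: weight_def sum_mono)

lemma weight_pos_iff: "weight w m > 0 \<longleftrightarrow> (\<exists>x\<in>Poly_Mapping.keys m. w x > 0)"
  by (auto simp: weight_def in_keys_iff simp flip: neq0_conv)

lemma weight_sum: "weight (\<lambda>x. \<Sum>i\<in>S. h i * g i x) m = (\<Sum>i\<in>S. h i * weight (g i) m)"
  by (simp add: weight_def sum_distrib_left sum.swap[of _ S] mult.left_commute)

lemma monom_deg_eq_weight: "monom_deg m = weight (\<lambda>_. 1) m"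
  by (simp add: monom_deg_def weight_def)

lemma lookup_le_monom_deg: "Poly_Mapping.lookup m x \<le> monom_deg m"
  by (cases "x \<in> Poly_Mapping.keys m") (auto simp: monom_deg_def in_keys_iff intro: member_le_sum)

lemma zero_in_monoms [simp]: "0 \<in> monoms X"
  by (simp add: monoms_def)

lemma single_in_monoms: "x \<in> X \<Longrightarrow> Poly_Mapping.single x k \<in> monoms X"
  by (simp add: monoms_def)

text \<open>Natural exponents cannot cancel, so the support of a product is exactly the union of the
  supports.\<close>

lemma add_in_monoms_iff [simp]: "m + n \<in> monoms X \<longleftrightarrow> m \<in> monoms X \<and> n \<in> monoms X"
  for m n :: "'x monom"
proof -
  have "Poly_Mapping.keys (m + n) = Poly_Mapping.keys m \<union> Poly_Mapping.keys n"
    by (auto simp: in_keys_iff lookup_add)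
  then show ?thesis by (simp add: monoms_def)
qed

lemma minus_in_monoms: "m \<in> monoms X \<Longrightarrow> m - n \<in> monoms X"
  for m n :: "'x monom"
  by (auto simp: monoms_def in_keys_iff lookup_minus subset_iff)

text \<open>Exponents are bounded by the degree, so these monomials embed into a finite space of
  functions on \<open>X\<close>.\<close>

lemma finite_monoms_deg_le:
  assumes "finite X"
  shows "finite {m \<in> monoms X. monom_deg m \<le> d}"
proof (rule finite_imageD)
  let ?f = "\<lambda>m. restrict (Poly_Mapping.lookup m) X"
  have "?f ` {m \<in> monoms X. monom_deg m \<le> d} \<subseteq> X \<rightarrow>\<^sub>E {..d}"
    using le_trans[OF lookup_le_monom_deg] by (auto simp: PiE_iff)
  then show "finite (?f ` {m \<in> monoms X. monom_deg m \<le> d})"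
    by (rule finite_subset) (simp add: assms finite_PiE)
  show "inj_on ?f {m \<in> monoms X. monom_deg m \<le> d}"
  proof (rule inj_onI, clarsimp simp: monoms_def)
    fix m n :: "'a monom"
    assume *: "Poly_Mapping.keys m \<subseteq> X" "Poly_Mapping.keys n \<subseteq> X" "?f m = ?f n"
    show "m = n"
    proof (rule poly_mapping_eqI)
      fix x
      show "Poly_Mapping.lookup m x = Poly_Mapping.lookup n x"
        using *(1,2) fun_cong[OF *(3), of x]
        by (cases "x \<in> X") (simp, metis in_keys_iff subsetD)
    qed
  qed
qed

section \<open>Polynomials and ideals\<close>

lemma add_in_polys: "p \<in> polys X \<Longrightarrow> q \<in> polys X \<Longrightarrow> p + q \<in> polys X"
  using Poly_Mapping.keys_add[of p q] by (auto simp: polys_def)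

lemma zero_in_polys: "0 \<in> polys X"
  by (simp add: polys_def)

lemma sum_in_polys: "(\<And>i. i \<in> S \<Longrightarrow> f i \<in> polys X) \<Longrightarrow> sum f S \<in> polys X"
  by (induction S rule: infinite_finite_induct) (auto intro: add_in_polys zero_in_polys)

lemma mult_in_polys: "p \<in> polys X \<Longrightarrow> q \<in> polys X \<Longrightarrow> p * q \<in> polys X"
  for p q :: "('x, 'k::comm_ring_1) mpoly"
  using Poly_Mapping.keys_mult[of p q] by (fastforce simp: polys_def)

lemma monom_poly_in_polys: "m \<in> monoms X \<Longrightarrow> monom_poly m \<in> polys X"
  by (simp add: monom_poly_def polys_def)

lemma monom_poly_add: "monom_poly (m + n) = monom_poly m * (monom_poly n :: ('x, 'k::comm_ring_1) mpoly)"
  by (simp add: monom_poly_def mult_single)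

lemma poly_ideal_mono: "A \<subseteq> A' \<Longrightarrow> poly_ideal X A \<subseteq> poly_ideal X A'"
  unfolding poly_ideal_def by blast

lemma poly_ideal_subset_if_multiples:
  assumes "\<And>a. a \<in> A \<Longrightarrow> \<exists>k b. k \<in> polys X \<and> b \<in> B \<and> a = k * b"
  shows "poly_ideal X A \<subseteq> poly_ideal X B"
proof
  fix p assume "p \<in> poly_ideal X A"
  then obtain F q where F: "finite F" "F \<subseteq> A" "\<And>a. a \<in> F \<Longrightarrow> q a \<in> polys X"
    and p: "p = (\<Sum>a\<in>F. q a * a)"
    unfolding poly_ideal_def by blast
  obtain k b where kb: "\<And>a. a \<in> A \<Longrightarrow> k a \<in> polys X \<and> b a \<in> B \<and> a = k a * b a"
    using assms by metis
  \<comment> \<open>Several \<open>a\<close> may be multiples of the same generator; their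
    coefficients are collected because \<open>poly_ideal\<close> takes one coefficient per
    generator.\<close>
  define q' where "q' c = (\<Sum>a | a \<in> F \<and> b a = c. q a * k a)" for c
  have "p = (\<Sum>a\<in>F. q a * k a * b a)"
    unfolding p using F(2) kb by (intro sum.cong) (auto simp: mult.assoc)
  also have "\<dots> = (\<Sum>c\<in>b ` F. \<Sum>a | a \<in> F \<and> b a = c. q a * k a * b a)"
    by (rule sum.image_gen[OF F(1)])
  also have "\<dots> = (\<Sum>c\<in>b ` F. q' c * c)"
    by (simp add: q'_def sum_distrib_right)
  finally have "p = (\<Sum>c\<in>b ` F. q' c * c)" .
  moreover have "q' c \<in> polys X" for c
    unfolding q'_def using F kb by (intro sum_in_polys mult_in_polys) auto
  moreover have "b ` F \<subseteq> B" using F kb by blast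
  ultimately show "p \<in> poly_ideal X B"
    unfolding poly_ideal_def using F(1) by blast
qed

section \<open>Weight orders and binomial Groebner bases\<close>

text \<open>The reductions are oriented by weight alone; the lexicographic tie-break, with variables
  ranked by \<open>e\<close>, serves to make the order linear.\<close>

definition weight_order :: "'x set \<Rightarrow> ('x \<Rightarrow> nat) \<Rightarrow> ('x \<Rightarrow> nat) \<Rightarrow> 'x monom rel" where
  "weight_order X e w = {(m, n). m \<in> monoms X \<and> n \<in> monoms X \<and>
     (weight w m < weight w n \<or> weight w m = weight w n \<and>
       (m = n \<or> (\<exists>x\<in>X. Poly_Mapping.lookup m x < Poly_Mapping.lookup n x \<and>
          (\<forall>y\<in>X. e y < e x \<longrightarrow> Poly_Mapping.lookup m y = Poly_Mapping.lookup n y))))}"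

lemma first_difference:
  assumes "m \<in> monoms X" "n \<in> monoms X" "m \<noteq> n"
  obtains x where "x \<in> X" "Poly_Mapping.lookup m x \<noteq> Poly_Mapping.lookup n x"
    "\<And>y. y \<in> X \<Longrightarrow> e y < (e x :: nat) \<Longrightarrow> Poly_Mapping.lookup m y = Poly_Mapping.lookup n y"
proof -
  let ?D = "\<lambda>x. x \<in> X \<and> Poly_Mapping.lookup m x \<noteq> Poly_Mapping.lookup n x"
  obtain z where "Poly_Mapping.lookup m z \<noteq> Poly_Mapping.lookup n z"
    using assms(3) by (meson poly_mapping_eqI)
  moreover from this have "z \<in> X"
    using assms(1,2) unfolding monoms_def by (metis (mono_tags) in_keys_iff mem_Collect_eq subsetD)
  ultimately have "?D z" by blast
  then obtain x where x: "?D x" and min: "\<And>y. ?D y \<Longrightarrow> e x \<le> e y"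
    using arg_min_nat_lemma[of ?D z e] by blast
  show thesis
    by (rule that[of x]) (use x min leD in \<open>blast+\<close>)
qed

lemma monomial_order_weight_order:
  assumes "inj_on e X"
  shows "monomial_order X (weight_order X e w)"
  unfolding monomial_order_def
proof (intro conjI ballI allI impI)
  let ?r = "weight_order X e w"
  show "linear_order_on (monoms X) ?r"
    unfolding order_on_defs
  proof (intro conjI)
    show "refl_on (monoms X) ?r" "?r \<subseteq> monoms X \<times> monoms X"
      by (auto simp: refl_on_def weight_order_def)
    show "trans ?r"
    proof (rule transI)
      fix l m n assume lm: "(l, m) \<in> ?r" and mn: "(m, n) \<in> ?r"
      show "(l, n) \<in> ?r"
      proof (cases "weight w l = weight w m \<and> weight w m = weight w n \<and> l \<noteq> m \<and> m \<noteq> n")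
        case True
        with lm obtain x where x: "x \<in> X" "Poly_Mapping.lookup l x < Poly_Mapping.lookup m x"
            "\<forall>y\<in>X. e y < e x \<longrightarrow> Poly_Mapping.lookup l y = Poly_Mapping.lookup m y"
          unfolding weight_order_def by auto
        from True mn obtain z where z: "z \<in> X" "Poly_Mapping.lookup m z < Poly_Mapping.lookup n z"
            "\<forall>y\<in>X. e y < e z \<longrightarrow> Poly_Mapping.lookup m y = Poly_Mapping.lookup n y"
          unfolding weight_order_def by auto
        \<comment> \<open>Injectivity of \<open>e\<close> excludes ties between distinct variables.
          The earlier of the two differences is where \<open>l\<close> and \<open>n\<close> first
          differ.\<close>
        consider "e x < e z" | "e z < e x" | "x = z"
          using assms x(1) z(1) by (meson inj_onD linorder_neqE_nat)
        then have "\<exists>x\<in>X. Poly_Mapping.lookup l x < Poly_Mapping.lookup n x \<and>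
            (\<forall>y\<in>X. e y < e x \<longrightarrow> Poly_Mapping.lookup l y = Poly_Mapping.lookup n y)"
        proof cases
          case 1 then show ?thesis using x z by (intro bexI[of _ x]) auto
        next
          case 2 then show ?thesis using x z by (intro bexI[of _ z]) auto
        next
          case 3 then show ?thesis using x z by (intro bexI[of _ x]) auto
        qed
        then show ?thesis using lm mn True unfolding weight_order_def by auto
      next
        case False
        then show ?thesis using lm mn unfolding weight_order_def by auto
      qed
    qed
    show "antisym ?r"
    proof (rule antisymI, rule ccontr)
      fix m n assume mn: "(m, n) \<in> ?r" "(n, m) \<in> ?r" "m \<noteq> n"
      then obtain x where x: "x \<in> X" "Poly_Mapping.lookup m x < Poly_Mapping.lookup n x"
          "\<forall>y\<in>X. e y < e x \<longrightarrow> Poly_Mapping.lookup m y = Poly_Mapping.lookup n y"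
        unfolding weight_order_def by auto
      from mn obtain z where z: "z \<in> X" "Poly_Mapping.lookup n z < Poly_Mapping.lookup m z"
          "\<forall>y\<in>X. e y < e z \<longrightarrow> Poly_Mapping.lookup n y = Poly_Mapping.lookup m y"
        unfolding weight_order_def by auto
      consider "e x < e z" | "e z < e x" | "x = z"
        using assms x(1) z(1) by (meson inj_onD linorder_neqE_nat)
      then show False using x z by cases auto
    qed
    show "total_on (monoms X) ?r"
    proof (rule total_onI)
      fix m n assume mn: "m \<in> monoms X" "n \<in> monoms X" "m \<noteq> n"
      obtain x where x: "x \<in> X" "Poly_Mapping.lookup m x \<noteq> Poly_Mapping.lookup n x"
          "\<And>y. y \<in> X \<Longrightarrow> e y < e x \<Longrightarrow> Poly_Mapping.lookup m y = Poly_Mapping.lookup n y"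
        using first_difference[OF mn, of e] by blast
      let ?lex = "\<lambda>m n. \<exists>x\<in>X. Poly_Mapping.lookup m x < Poly_Mapping.lookup n x \<and>
        (\<forall>y\<in>X. e y < e x \<longrightarrow> Poly_Mapping.lookup m y = Poly_Mapping.lookup n y)"
      consider "Poly_Mapping.lookup m x < Poly_Mapping.lookup n x"
        | "Poly_Mapping.lookup n x < Poly_Mapping.lookup m x" using x(2) by linarith
      then have "?lex m n \<or> ?lex n m"
      proof cases
        case 1 then have "?lex m n" using x by blast
        then show ?thesis ..
      next
        case 2 then have "?lex n m" using x by (intro bexI[of _ x]) auto
        then show ?thesis ..
      qed
      then show "(m, n) \<in> ?r \<or> (n, m) \<in> ?r"
        using mn(1,2) linorder_less_linear[of "weight w m" "weight w n"]
        unfolding weight_order_def by (elim disjE) simp_all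
    qed
  qed
  show "(0, m) \<in> ?r" if m: "m \<in> monoms X" for m
  proof (cases "m = 0")
    case False
    then obtain x where "x \<in> X" "Poly_Mapping.lookup 0 x \<noteq> Poly_Mapping.lookup m x"
        "\<And>y. y \<in> X \<Longrightarrow> e y < e x \<Longrightarrow> Poly_Mapping.lookup 0 y = Poly_Mapping.lookup m y"
      using first_difference[of 0 X m e] m by auto
    then show ?thesis using m unfolding weight_order_def by auto
  qed (auto simp: weight_order_def)
  show "(m + k, n + k) \<in> ?r" if "(m, n) \<in> ?r" "k \<in> monoms X" for m n k
    using that unfolding weight_order_def by (simp add: lookup_add)
qed

lemma weight_order_weight_le: "(m, n) \<in> weight_order X e w \<Longrightarrow> weight w m \<le> weight w n"
  by (auto simp: weight_order_def)

lemma finite_linear_order_greatest: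
  assumes "linear_order_on A r" "finite S" "S \<noteq> {}" "S \<subseteq> A"
  shows "\<exists>m\<in>S. \<forall>n\<in>S. (n, m) \<in> r"
  using assms(2-)
proof (induction rule: finite_ne_induct)
  case (singleton x)
  then show ?case using assms(1) by (auto simp: order_on_defs refl_on_def)
next
  case (insert x F)
  then obtain m where m: "m \<in> F" "\<forall>n\<in>F. (n, m) \<in> r" by auto
  have "x \<in> A" "m \<in> A" using insert.prems m(1) by auto
  then have "(x, m) \<in> r \<or> (m, x) \<in> r"
    using assms(1) by (cases "x = m") (auto simp: order_on_defs refl_on_def total_on_def)
  moreover have "(x, x) \<in> r" "trans r"
    using assms(1) \<open>x \<in> A\<close> by (auto simp: order_on_defs refl_on_def)
  ultimately show ?case using m by (auto dest: transD)
qed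

lemma lead_monom_eqI:
  assumes "monomial_order X r" "m \<in> Poly_Mapping.keys p" "\<And>n. n \<in> Poly_Mapping.keys p \<Longrightarrow> (n, m) \<in> r"
  shows "lead_monom r p = m"
  unfolding lead_monom_def
  by (rule the_equality)
    (use assms in \<open>auto simp: monomial_order_def order_on_defs dest: antisymD\<close>)

lemma lead_monom_props:
  assumes "monomial_order X r" "p \<in> polys X" "p \<noteq> 0"
  shows "lead_monom r p \<in> Poly_Mapping.keys p"
    and "\<And>n. n \<in> Poly_Mapping.keys p \<Longrightarrow> (n, lead_monom r p) \<in> r"
proof -
  have "\<exists>m\<in>Poly_Mapping.keys p. \<forall>n\<in>Poly_Mapping.keys p. (n, m) \<in> r"
    by (rule finite_linear_order_greatest[of "monoms X"])
      (use assms in \<open>auto simp: monomial_order_def polys_def\<close>)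
  then obtain m where m: "m \<in> Poly_Mapping.keys p" "\<And>n. n \<in> Poly_Mapping.keys p \<Longrightarrow> (n, m) \<in> r"
    by blast
  moreover have "lead_monom r p = m" by (rule lead_monom_eqI[OF assms(1) m])
  ultimately show "lead_monom r p \<in> Poly_Mapping.keys p"
    "\<And>n. n \<in> Poly_Mapping.keys p \<Longrightarrow> (n, lead_monom r p) \<in> r" by auto
qed

lemma keys_binomial:
  assumes "m \<noteq> n"
  shows "Poly_Mapping.keys (monom_poly m - monom_poly n :: ('x, 'k::field) mpoly) = {m, n}"
  using assms by (auto simp: monom_poly_def in_keys_iff lookup_minus lookup_single when_def split: if_splits)

text \<open>The order never contradicts the weight, so by totality a strict difference in weight
  decides the comparison.\<close>

lemma lead_monom_binomial:
  assumes "monomial_order X r" "\<And>m n. (m, n) \<in> r \<Longrightarrow> weight w m \<le> weight w n"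
    and "m \<in> monoms X" "n \<in> monoms X" "weight w n < weight w m"
  shows "lead_monom r (monom_poly m - monom_poly n :: ('x, 'k::field) mpoly) = m"
proof -
  have r: "(m, m) \<in> r" "(n, m) \<in> r \<or> (m, n) \<in> r"
    using assms(1,3,4,5) by (auto simp: monomial_order_def order_on_defs refl_on_def total_on_def)
  then have "(n, m) \<in> r" using assms(2)[of m n] assms(5) by auto
  moreover have "m \<noteq> n" using assms(5) by auto
  ultimately show ?thesis
    using r(1) by (intro lead_monom_eqI[OF assms(1)]) (auto simp: keys_binomial)
qed

text \<open>Every fibre of \<open>\<mu>\<close> has at most one monomial outside the ideal of the leading terms, and
  that monomial is the one of least weight. A leading monomial outside this ideal is impossible,
  because the other terms in its fibre would have smaller weight.\<close>

lemma groebner_basis_binomials: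
  fixes \<mu> :: "'x monom \<Rightarrow> 'z" and I :: "('x, 'k::field) mpoly set"
  assumes ord: "monomial_order X r"
    and wt: "\<And>m n. (m, n) \<in> r \<Longrightarrow> weight w m \<le> weight w n"
    and I: "I = {p \<in> polys X. \<forall>y. (\<Sum>m | m \<in> Poly_Mapping.keys p \<and> \<mu> m = y. Poly_Mapping.lookup p m) = 0}"
    and \<mu>: "\<And>m n k. \<mu> (m + k) = \<mu> (n + k) \<longleftrightarrow> \<mu> m = \<mu> n"
    and P: "finite P" "\<And>m n. (m, n) \<in> P \<Longrightarrow>
      m \<in> monoms X \<and> n \<in> monoms X \<and> \<mu> m = \<mu> n \<and> weight w n < weight w m"
    and div: "\<And>m n. \<lbrakk>m \<in> monoms X; n \<in> monoms X; m \<noteq> n; \<mu> m = \<mu> n;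
        Poly_Mapping.keys m \<inter> Poly_Mapping.keys n = {}\<rbrakk> \<Longrightarrow>
      \<exists>(a, b)\<in>P. (\<exists>k. m = a + k) \<or> (\<exists>k. n = a + k)"
  shows "groebner_basis X r I ((\<lambda>(m, n). monom_poly m - monom_poly n) ` P)"
proof -
  let ?b = "\<lambda>(m, n). monom_poly m - monom_poly n :: ('x, 'k) mpoly"
  let ?red = "\<lambda>m. \<exists>(a, b)\<in>P. \<exists>k. m = a + k"
  have div': "?red m \<or> ?red n" if "m \<in> monoms X" "n \<in> monoms X" "m \<noteq> n" "\<mu> m = \<mu> n" for m n
  proof -
    \<comment> \<open>Truncated subtraction makes \<open>g\<close> the greatest common divisor.
      Cancelling it leaves monomials of disjoint support that still share a fibre, as
      \<open>div\<close> requires.\<close>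
    define g where "g = m - (m - n)"
    have m: "m = (m - n) + g" and n: "n = (n - m) + g"
      by (rule poly_mapping_eqI; simp add: g_def lookup_add lookup_minus)+
    have "\<mu> (m - n) = \<mu> (n - m)" using \<mu>[of "m - n" g "n - m"] m n that(4) by metis
    moreover have "m - n \<noteq> n - m" using m n that(3) by metis
    moreover have "Poly_Mapping.keys (m - n) \<inter> Poly_Mapping.keys (n - m) = {}"
      by (auto simp: in_keys_iff lookup_minus)
    ultimately have "\<exists>(a, b)\<in>P. (\<exists>k. m - n = a + k) \<or> (\<exists>k. n - m = a + k)"
      by (intro div minus_in_monoms that)
    then obtain a b k where ab: "(a, b) \<in> P" "m - n = a + k \<or> n - m = a + k" by blast
    have "m = a + (k + g) \<or> n = a + (k + g)"
      using ab(2)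
    proof
      assume "m - n = a + k"
      with m have "m = a + k + g" by simp
      then show ?thesis by (simp add: add.assoc)
    next
      assume "n - m = a + k"
      with n have "n = a + k + g" by simp
      then show ?thesis by (simp add: add.assoc)
    qed
    then show ?thesis using ab(1) by blast
  qed
  have neq: "m \<noteq> n" if "(m, n) \<in> P" for m n using P(2)[OF that] by auto
  have lead: "lead_monom r (?b (m, n)) = m" if "(m, n) \<in> P" for m n
    using P(2)[OF that] by (simp add: lead_monom_binomial[OF ord wt])
  have nz: "?b (m, n) \<noteq> 0" if "(m, n) \<in> P" for m n
    using keys_binomial[OF neq[OF that], where 'k = 'k] by auto
  have sub: "?b ` P \<subseteq> I"
  proof clarify
    fix m n assume mn: "(m, n) \<in> P"
    have "monom_poly m - monom_poly n \<in> (polys X :: ('x, 'k) mpoly set)"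
      using P(2)[OF mn] keys_binomial[OF neq[OF mn], where 'k = 'k] by (simp add: polys_def)
    moreover have "(\<Sum>k | k \<in> {m, n} \<and> \<mu> k = y.
        Poly_Mapping.lookup (monom_poly m - monom_poly n :: ('x, 'k) mpoly) k) = 0" for y
    proof -
      have "{k. k \<in> {m, n} \<and> \<mu> k = y} = (if \<mu> m = y then {m, n} else {})"
        using P(2)[OF mn] by auto
      then show ?thesis
        using neq[OF mn] by (simp add: monom_poly_def lookup_minus lookup_single when_def)
    qed
    ultimately show "monom_poly m - monom_poly n \<in> I"
      by (simp add: I keys_binomial[OF neq[OF mn]])
  qed
  have red: "?red (lead_monom r f)" if f: "f \<in> I" "f \<noteq> 0" for f
  proof (rule ccontr)
    let ?m = "lead_monom r f"
    assume nred: "\<not> ?red ?m"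
    have fX: "f \<in> polys X" using f I by simp
    note lm = lead_monom_props[OF ord fX f(2)]
    let ?F = "{m \<in> Poly_Mapping.keys f. \<mu> m = \<mu> ?m}"
    have "(\<Sum>m\<in>?F. Poly_Mapping.lookup f m) = 0" using f(1) I by auto
    moreover have "Poly_Mapping.lookup f ?m \<noteq> 0" using lm(1) by (simp add: in_keys_iff)
    \<comment> \<open>The coefficients in the fibre sum to zero while the leading one is nonzero, so
      the fibre contains another term of \<open>f\<close>.\<close>
    ultimately have "?F \<noteq> {?m}" by auto
    then obtain m' where m': "m' \<in> Poly_Mapping.keys f" "\<mu> m' = \<mu> ?m" "m' \<noteq> ?m"
      using lm(1) by blast
    have X: "?m \<in> monoms X" "m' \<in> monoms X" using lm(1) m'(1) fX by (auto simp: polys_def)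
    let ?N = "\<lambda>n. n \<in> monoms X \<and> \<mu> n = \<mu> ?m"
    define n where "n = arg_min (weight w) ?N"
    have n: "?N n" and min: "\<And>l. ?N l \<Longrightarrow> weight w n \<le> weight w l"
      using arg_min_nat_lemma[of ?N ?m "weight w"] X unfolding n_def by auto
    \<comment> \<open>A reduction would stay in the fibre and lower the weight below the
      minimum.\<close>
    have irr: "\<not> ?red l" if "?N l" "weight w l = weight w n" for l
    proof
      assume "?red l"
      then obtain a b k where ab: "(a, b) \<in> P" "l = a + k" by blast
      have "?N (b + k)" using P(2)[OF ab(1)] \<mu>[of a k b] that(1) ab(2) by auto
      then have "weight w n \<le> weight w (b + k)" by (rule min)
      also have "\<dots> < weight w l" using P(2)[OF ab(1)] ab(2) by simp
      finally show False using that(2) by simp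
    qed
    \<comment> \<open>Two irreducible monomials of one fibre coincide, so \<open>?m\<close> has
      least weight. As \<open>m'\<close> is not heavier than the leading monomial, it has least
      weight too and is a second irreducible one.\<close>
    have "n = ?m" using div'[of n ?m] irr[of n] nred n X by blast
    then have "weight w m' = weight w n"
      using wt[OF lm(2)[OF m'(1)]] min[of m'] X(2) m'(2) by simp
    then show False using div'[of m' ?m] irr[of m'] nred m' X by blast
  qed
  have "lead_ideal X r I \<subseteq> lead_ideal X r (?b ` P)"
    unfolding lead_ideal_def
  proof (rule poly_ideal_subset_if_multiples)
    fix q :: "('x, 'k) mpoly" assume "q \<in> (\<lambda>f. monom_poly (lead_monom r f)) ` (I - {0})"
    then obtain f where f: "f \<in> I" "f \<noteq> 0" "q = monom_poly (lead_monom r f)" by blast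
    obtain a b k where ab: "(a, b) \<in> P" "lead_monom r f = a + k" using red[OF f(1,2)] by blast
    have "lead_monom r f \<in> monoms X"
      using lead_monom_props(1)[OF ord _ f(2)] f(1) by (auto simp: I polys_def)
    then have "k \<in> monoms X" using ab(2) by simp
    moreover have "?b (a, b) \<in> ?b ` P - {0}" using ab(1) nz[OF ab(1)] by blast
    then have "monom_poly a \<in> (\<lambda>f. monom_poly (lead_monom r f)) ` (?b ` P - {0})"
      by (rule rev_image_eqI) (simp only: lead[OF ab(1)])
    moreover have "q = monom_poly k * monom_poly a"
      by (simp only: f(3) ab(2) monom_poly_add mult.commute)
    ultimately show "\<exists>k b. k \<in> polys X \<and> b \<in> (\<lambda>f. monom_poly (lead_monom r f)) ` (?b ` P - {0}) \<and> q = k * b"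
      using monom_poly_in_polys by blast
  qed
  moreover have "lead_ideal X r (?b ` P) \<subseteq> lead_ideal X r I"
    unfolding lead_ideal_def using sub by (intro poly_ideal_mono) blast
  moreover have "0 \<notin> ?b ` P" using nz by fastforce
  ultimately show ?thesis
    unfolding groebner_basis_def using P(1) sub by blast
qed

section \<open>The kernel of a monomial map\<close>

text \<open>The exponent vector of the image of the variable \<phi> under \<open>Phi\<close>;
  \<open>image_monom\<close> extends it additively to monomials.\<close>

definition hom_monom :: "'v ugraph \<Rightarrow> ('v \<Rightarrow> 'h) \<Rightarrow> ('v set \<times> ('v \<Rightarrow> 'h)) monom" where
  "hom_monom G \<phi> = (\<Sum>e\<in>edges G. Poly_Mapping.single (e, restrict \<phi> e) 1)"

definition image_monom :: "'v ugraph \<Rightarrow> ('v \<Rightarrow> 'h) monom \<Rightarrow> ('v set \<times> ('v \<Rightarrow> 'h)) monom" where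
  "image_monom G m = (\<Sum>\<phi>\<in>Poly_Mapping.keys m. \<Sum>i<Poly_Mapping.lookup m \<phi>. hom_monom G \<phi>)"

lemma prod_monom_poly:
  "(\<Prod>i\<in>S. monom_poly (f i) :: ('x, 'k::comm_ring_1) mpoly) = monom_poly (\<Sum>i\<in>S. f i)"
proof (induction S rule: infinite_finite_induct)
  case (insert x F)
  then show ?case by (simp add: monom_poly_add)
qed (simp_all add: monom_poly_def)

lemma lookup_image_monom:
  "Poly_Mapping.lookup (image_monom G m) y = weight (\<lambda>\<phi>. Poly_Mapping.lookup (hom_monom G \<phi>) y) m"
  by (simp add: image_monom_def weight_def lookup_sum)

lemma image_monom_add [simp]: "image_monom G (m + n) = image_monom G m + image_monom G n"
  by (rule poly_mapping_eqI) (simp add: lookup_add lookup_image_monom)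

lemma image_monom_single [simp]: "image_monom G (Poly_Mapping.single \<phi> 1) = hom_monom G \<phi>"
  by (rule poly_mapping_eqI) (simp add: lookup_image_monom)

lemma image_monom_0 [simp]: "image_monom G 0 = 0"
  by (simp add: image_monom_def)

text \<open>Each variable is sent to a monomial, hence each term to a term with the same
  coefficient.\<close>

lemma Phi_eq:
  fixes G :: "'v ugraph" and p :: "('v \<Rightarrow> 'h, 'k::field) mpoly"
  shows "Phi G p = (\<Sum>m\<in>Poly_Mapping.keys p.
     Poly_Mapping.single (image_monom G m) (Poly_Mapping.lookup p m))"
proof -
  have var: "(\<Prod>e\<in>edges G. poly_var (e, restrict \<phi> e)) = (monom_poly (hom_monom G \<phi>) :: (_, 'k) mpoly)" for \<phi> :: "'v \<Rightarrow> 'h"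
    using prod_monom_poly[of "\<lambda>e. Poly_Mapping.single (e, restrict \<phi> e) 1" "edges G"]
    by (simp add: poly_var_def monom_poly_def hom_monom_def)
  have power: "(monom_poly a :: (_, 'k) mpoly) ^ k = monom_poly (\<Sum>i<k. a)"
    for a :: "('v set \<times> ('v \<Rightarrow> 'h)) monom" and k
    using prod_monom_poly[of "\<lambda>_. a" "{..<k}", where 'k = 'k] by (simp only: prod_constant card_lessThan)
  show ?thesis
    unfolding Phi_def subst_poly_def var power prod_monom_poly image_monom_def[symmetric]
    by (simp add: monom_poly_def mult_single)
qed

text \<open>The coefficient of the image at \<open>y\<close> collects the coefficients over the
  fibre of \<open>y\<close>. This is the form of the ideal in
  \<open>groebner_basis_binomials\<close>.\<close>

lemma hom_ideal_eq:
  fixes G :: "'v ugraph"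
  shows "(hom_ideal G H :: ('v \<Rightarrow> 'h, 'k::field) mpoly set) = {p \<in> polys (Hom G H).
    \<forall>y. (\<Sum>m | m \<in> Poly_Mapping.keys p \<and> image_monom G m = y. Poly_Mapping.lookup p m) = 0}"
proof -
  have "Poly_Mapping.lookup (Phi G p) y =
      (\<Sum>m | m \<in> Poly_Mapping.keys p \<and> image_monom G m = y. Poly_Mapping.lookup p m)"
    for p :: "('v \<Rightarrow> 'h, 'k) mpoly" and y
    by (simp add: Phi_eq lookup_sum lookup_single when_def sum.If_cases Int_def)
  then have "Phi G p = 0 \<longleftrightarrow>
      (\<forall>y. (\<Sum>m | m \<in> Poly_Mapping.keys p \<and> image_monom G m = y. Poly_Mapping.lookup p m) = 0)"
    for p :: "('v \<Rightarrow> 'h, 'k) mpoly"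
    by (simp add: poly_mapping_eq_iff fun_eq_iff)
  then show ?thesis by (simp add: hom_ideal_def)
qed

text \<open>The loop at \<open>True\<close> is the only pair missing from the target. The case
  \<open>u = w\<close> keeps looped vertices out of every independent set.\<close>

lemma Hom_Lambda_iff:
  "\<phi> \<in> Hom G Lambda_graph \<longleftrightarrow>
     \<phi> \<in> extensional (verts G) \<and> (\<forall>u w. {u, w} \<in> edges G \<longrightarrow> \<not> (\<phi> u \<and> \<phi> w))"
proof -
  have "{p, q} \<in> edges Lambda_graph \<longleftrightarrow> \<not> (p \<and> q)" for p q
    by (cases p; cases q) (auto simp: Lambda_graph_def)
  moreover have "\<phi> \<in> verts G \<rightarrow>\<^sub>E verts Lambda_graph \<longleftrightarrow> \<phi> \<in> extensional (verts G)"
    by (auto simp: Lambda_graph_def PiE_def)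
  ultimately show ?thesis by (simp add: Hom_def)
qed

section \<open>Independent sets of almost bipartite graphs\<close>

text \<open>A loop can only sit at \<open>v\<close>, since any other edge avoiding \<open>v\<close>
  joins the disjoint sides.\<close>

locale almost_bipartite_graph =
  fixes G :: "'v ugraph" and v :: 'v and A B :: "'v set"
  assumes graph: "graph G"
    and apex: "v \<in> verts G"
    and sides: "A \<union> B = verts G - {v}" "A \<inter> B = {}"
    and crossing: "\<And>e. e \<in> edges G \<Longrightarrow> v \<notin> e \<Longrightarrow> \<exists>a\<in>A. \<exists>b\<in>B. e = {a, b}"
begin

abbreviation "X \<equiv> Hom G Lambda_graph"

lemma finite_verts: "finite (verts G)"
  using graph by (simp add: graph_def)

lemma edge_subset: "e \<in> edges G \<Longrightarrow> e \<subseteq> verts G"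
  using graph by (simp add: graph_def)

lemma finite_edges: "finite (edges G)"
  using finite_verts edge_subset by (auto intro: finite_subset[of _ "Pow (verts G)"])

lemma edgeE:
  assumes "e \<in> edges G"
  obtains x y where "e = {x, y}"
proof -
  have "card e = 1 \<or> card e = 2" using assms graph by (simp add: graph_def)
  then show thesis using that by (metis card_1_singletonE card_2_iff insert_absorb2)
qed

lemma finite_X: "finite X"
  unfolding Hom_def Lambda_graph_def
  by (rule finite_subset[OF _ finite_PiE[of "verts G" "\<lambda>_. UNIV"]]) (auto simp: finite_verts)

text \<open>Every edge meets \<open>v\<close> or joins the two sides, so these two checks suffice.
  They are made for each result of an exchange.\<close>

lemma in_XI:
  assumes "\<phi> \<in> extensional (verts G)"
    and "\<And>a b. a \<in> A \<Longrightarrow> b \<in> B \<Longrightarrow> {a, b} \<in> edges G \<Longrightarrow> \<phi> a \<Longrightarrow> \<phi> b \<Longrightarrow> False"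
    and "\<And>x. {v, x} \<in> edges G \<Longrightarrow> \<phi> v \<Longrightarrow> \<phi> x \<Longrightarrow> False"
  shows "\<phi> \<in> X"
  unfolding Hom_Lambda_iff
proof (intro conjI allI impI notI)
  fix u w assume uw: "{u, w} \<in> edges G" "\<phi> u \<and> \<phi> w"
  consider "u = v" | "w = v" | "v \<notin> {u, w}" by auto
  then show False
  proof cases
    case 1 then show ?thesis using uw assms(3)[of w] by auto
  next
    case 2 then show ?thesis using uw assms(3)[of u] by (auto simp: insert_commute)
  next
    case 3
    then obtain a b where "a \<in> A" "b \<in> B" "{u, w} = {a, b}" using crossing[OF uw(1)] by auto
    then show ?thesis using uw assms(2)[of a b] by (metis doubleton_eq_iff)
  qed
qed (rule assms(1))

lemma not_both: "\<phi> \<in> X \<Longrightarrow> {x, y} \<in> edges G \<Longrightarrow> \<phi> x \<Longrightarrow> \<phi> y \<Longrightarrow> False"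
  by (auto simp: Hom_Lambda_iff)

lemma X_eqI:
  assumes "\<phi> \<in> X" "\<psi> \<in> X" "\<And>x. x \<in> verts G \<Longrightarrow> \<phi> x = \<psi> x"
  shows "\<phi> = \<psi>"
  using assms by (intro extensionalityI[of _ "verts G"]) (auto simp: Hom_Lambda_iff)

section \<open>Exchanges between two independent sets\<close>

text \<open>The choice is free at each vertex; independence of \<open>P\<close> and \<open>Q\<close>
  is always demanded separately.\<close>

definition swapped where
  "swapped S T P Q \<longleftrightarrow> (\<forall>x\<in>verts G. P x = S x \<and> Q x = T x \<or> P x = T x \<and> Q x = S x)"
  for S T P Q :: "'v \<Rightarrow> bool"

text \<open>Exchanging at one endpoint of an edge only has the effect of exchanging at both or at
  none, unless \<open>S\<close> and \<open>T\<close> contain opposite endpoints. In that case one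
  result would contain both endpoints. So on each edge the two restrictions are merely
  permuted.\<close>

lemma hom_monom_swap:
  assumes "swapped S T P Q" "S \<in> X" "T \<in> X" "P \<in> X" "Q \<in> X"
  shows "hom_monom G S + hom_monom G T = hom_monom G P + hom_monom G Q"
  unfolding hom_monom_def sum.distrib[symmetric]
proof (rule sum.cong)
  fix e assume e: "e \<in> edges G"
  then obtain x y where xy: "e = {x, y}" by (rule edgeE)
  then have "x \<in> verts G" "y \<in> verts G" using edge_subset[OF e] by auto
  then have x: "P x = S x \<and> Q x = T x \<or> P x = T x \<and> Q x = S x"
    and y: "P y = S y \<and> Q y = T y \<or> P y = T y \<and> Q y = S y"
    using assms(1) by (auto simp: swapped_def)
  have "\<not> (\<phi> x \<and> \<phi> y)" if "\<phi> \<in> X" for \<phi> using not_both that e xy by auto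
  then have "\<not> (S x \<and> S y)" "\<not> (T x \<and> T y)" "\<not> (P x \<and> P y)" "\<not> (Q x \<and> Q y)"
    using assms by auto
  then have "(P x = S x \<and> Q x = T x) \<and> (P y = S y \<and> Q y = T y) \<or>
      (P x = T x \<and> Q x = S x) \<and> (P y = T y \<and> Q y = S y)"
    using x y by argo
  then have "restrict P e = restrict S e \<and> restrict Q e = restrict T e \<or>
      restrict P e = restrict T e \<and> restrict Q e = restrict S e"
    by (auto simp: xy restrict_def fun_eq_iff)
  then show "Poly_Mapping.single (e, restrict S e) 1 + Poly_Mapping.single (e, restrict T e) 1 =
      Poly_Mapping.single (e, restrict P e) (1::nat) + Poly_Mapping.single (e, restrict Q e) 1"
    by (auto simp: add.commute)
qed simp

text \<open>The exponent of the image at \<open>(e, \<chi>)\<close> counts how often the restriction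
  \<chi> occurs. Any statistic of the restrictions to \<open>e\<close> is therefore a linear
  function of the image.\<close>

lemma weight_edge_cong:
  assumes "e \<in> edges G" "image_monom G n = image_monom G n'"
  shows "weight (\<lambda>\<phi>. h (restrict \<phi> e)) n = weight (\<lambda>\<phi>. h (restrict \<phi> e)) (n' :: ('v \<Rightarrow> bool) monom)"
proof -
  let ?F = "e \<rightarrow>\<^sub>E (UNIV :: bool set)"
  have fin: "finite ?F"
    using assms(1) finite_verts edge_subset by (intro finite_PiE) (auto intro: finite_subset)
  have "Poly_Mapping.lookup (hom_monom G \<phi>) (e, \<chi>) = of_bool (restrict \<phi> e = \<chi>)" for \<phi> and \<chi> :: "'v \<Rightarrow> bool"
  proof -
    have "Poly_Mapping.lookup (hom_monom G \<phi>) (e, \<chi>) =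
        (\<Sum>d\<in>edges G. if d = e then of_bool (restrict \<phi> e = \<chi>) else 0)"
      unfolding hom_monom_def lookup_sum
      by (intro sum.cong) (auto simp: lookup_single when_def)
    then show ?thesis using assms(1) finite_edges by simp
  qed
  then have "h (restrict \<phi> e) = (\<Sum>\<chi>\<in>?F. h \<chi> * Poly_Mapping.lookup (hom_monom G \<phi>) (e, \<chi>))" for \<phi>
    using fin by (simp add: of_bool_def if_distrib[of "\<lambda>t. _ * t"] cong: if_cong)
  then have "weight (\<lambda>\<phi>. h (restrict \<phi> e)) m =
      (\<Sum>\<chi>\<in>?F. h \<chi> * Poly_Mapping.lookup (image_monom G m) (e, \<chi>))" for m
    by (simp add: weight_sum lookup_image_monom)
  then show ?thesis using assms(2) by simp
qed

text \<open>The coefficient of \<open>v\<close> is so negative that every independent set containing \<open>v\<close> has smaller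
  level than every independent set avoiding \<open>v\<close>.\<close>

definition level :: "('v \<Rightarrow> bool) \<Rightarrow> int" where
  "level \<phi> = (\<Sum>x\<in>verts G. (if x = v then - 2 * int (card (verts G)) - 1 else if x \<in> A then 1 else - 1)
     * of_bool (\<phi> x))"

lemma level_swap: "swapped S T P Q \<Longrightarrow> level P + level Q = level S + level T"
  unfolding level_def sum.distrib[symmetric] swapped_def
  by (intro sum.cong) auto

lemma level_less:
  assumes "\<phi> v = \<psi> v" "\<And>a. a \<in> A \<Longrightarrow> \<phi> a \<Longrightarrow> \<psi> a" "\<And>b. b \<in> B \<Longrightarrow> \<psi> b \<Longrightarrow> \<phi> b"
    and "x \<in> verts G" "\<phi> x \<noteq> \<psi> x"
  shows "level \<phi> < level \<psi>"
  unfolding level_def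
proof (rule sum_strict_mono_ex1)
  have *: "y = v \<or> y \<in> A \<and> y \<noteq> v \<or> y \<in> B \<and> y \<noteq> v \<and> y \<notin> A" if "y \<in> verts G" for y
    using sides that by blast
  show "\<forall>y\<in>verts G. (if y = v then - 2 * int (card (verts G)) - 1 else if y \<in> A then 1 else - 1)
     * of_bool (\<phi> y) \<le> (if y = v then - 2 * int (card (verts G)) - 1 else if y \<in> A then 1 else - 1)
     * of_bool (\<psi> y)"
    using * assms(1-3) by fastforce
  show "\<exists>y\<in>verts G. (if y = v then - 2 * int (card (verts G)) - 1 else if y \<in> A then 1 else - 1)
     * of_bool (\<phi> y) < (if y = v then - 2 * int (card (verts G)) - 1 else if y \<in> A then 1 else - 1)
     * of_bool (\<psi> y)"
    using *[OF assms(4)] assms by (intro bexI[of _ x]) auto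
qed (rule finite_verts)

text \<open>The vertices other than \<open>v\<close> contribute between \<open>-N\<close> and
  \<open>N\<close>, so they cannot make up for the \<open>2 * N + 1\<close> that \<open>v\<close>
  costs.\<close>

lemma level_less_apex:
  assumes "\<phi> v" "\<not> \<psi> v"
  shows "level \<phi> < level \<psi>"
proof -
  define N where "N = int (card (verts G))"
  define l where "l \<phi> = (\<Sum>x\<in>verts G - {v}. (if x \<in> A then 1 else - 1) * of_bool (\<phi> x) :: int)" for \<phi>
  have "level \<phi> = (- 2 * N - 1) * of_bool (\<phi> v) + l \<phi>" for \<phi>
    unfolding level_def l_def N_def sum.remove[OF finite_verts apex]
    by (intro arg_cong2[where f = "(+)"] sum.cong) auto
  moreover have "\<bar>l \<phi>\<bar> \<le> N" for \<phi>
  proof -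
    have "\<bar>l \<phi>\<bar> \<le> (\<Sum>x\<in>verts G - {v}. 1)"
      unfolding l_def by (rule order_trans[OF sum_abs], rule sum_mono) simp
    also have "\<dots> \<le> N" unfolding N_def by (simp add: card_mono finite_verts)
    finally show ?thesis .
  qed
  from this[of \<phi>] this[of \<psi>] have "- 2 * N - 1 + l \<phi> < l \<psi>" by linarith
  ultimately show ?thesis using assms by simp
qed

section \<open>Isolated vertices and weights of independent sets\<close>

definition isolated :: "'v set" where
  "isolated = {x \<in> verts G. \<forall>e\<in>edges G. x \<notin> e}"

definition isolated_count :: "('v \<Rightarrow> bool) \<Rightarrow> nat" where
  "isolated_count \<phi> = (\<Sum>x\<in>isolated. of_bool (\<phi> x))"

lemma isolated_count_swap:
  "swapped S T P Q \<Longrightarrow> isolated_count P + isolated_count Q = isolated_count S + isolated_count T"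
  unfolding isolated_count_def sum.distrib[symmetric] swapped_def
  by (intro sum.cong) (auto simp: isolated_def)

text \<open>Exceeds every squared level, so that the subtraction in \<open>hom_weight\<close> never
  truncates and one isolated vertex outweighs any squared level.\<close>

definition level_bound :: nat where
  "level_bound = 1 + (\<Sum>\<phi>\<in>X. nat ((level \<phi>)\<^sup>2))"

text \<open>Smaller is preferred. The constant \<open>level_bound\<close> per variable turns the
  negated squared level into a positive natural number without affecting comparisons in equal
  degree.\<close>

definition hom_weight :: "('v \<Rightarrow> bool) \<Rightarrow> nat" where
  "hom_weight \<phi> = level_bound * (1 + isolated_count \<phi>) - nat ((level \<phi>)\<^sup>2)"

lemma level_bound: "\<phi> \<in> X \<Longrightarrow> nat ((level \<phi>)\<^sup>2) < level_bound"
  unfolding level_bound_def using member_le_sum[of \<phi> X "\<lambda>\<phi>. nat ((level \<phi>)\<^sup>2)"] finite_X by simp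

lemma hom_weight_pos: "\<phi> \<in> X \<Longrightarrow> 0 < hom_weight \<phi>"
  using level_bound[of \<phi>] by (simp add: hom_weight_def trans_less_add1)

lemma int_hom_weight:
  assumes "\<phi> \<in> X"
  shows "int (hom_weight \<phi>) = int level_bound * (1 + int (isolated_count \<phi>)) - (level \<phi>)\<^sup>2"
proof -
  have "nat ((level \<phi>)\<^sup>2) \<le> level_bound * (1 + isolated_count \<phi>)"
    using level_bound[OF assms] by (simp add: trans_le_add1)
  then show ?thesis by (simp add: hom_weight_def of_nat_diff algebra_simps)
qed

text \<open>Convexity: the sum of the levels is fixed and \<open>P\<close> lies below both old sets,
  so the levels spread apart. The sum of squares grows by twice the product of the two drops to
  \<open>level P\<close>.\<close>

lemma hom_weight_swap:
  assumes "swapped S T P Q" "S \<in> X" "T \<in> X" "P \<in> X" "Q \<in> X"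
    and "level P < level S" "level P < level T"
  shows "hom_weight P + hom_weight Q < hom_weight S + hom_weight T"
proof -
  have Q: "level Q = level S + level T - level P" using level_swap[OF assms(1)] by simp
  have "0 < 2 * ((level S - level P) * (level T - level P))" using assms(6,7) by simp
  also have "\<dots> = (level P)\<^sup>2 + (level Q)\<^sup>2 - (level S)\<^sup>2 - (level T)\<^sup>2"
    unfolding Q by (simp add: power2_eq_square algebra_simps)
  finally have "(level S)\<^sup>2 + (level T)\<^sup>2 < (level P)\<^sup>2 + (level Q)\<^sup>2" by simp
  moreover have "int level_bound * (1 + int (isolated_count P)) + int level_bound * (1 + int (isolated_count Q))
      = int level_bound * (1 + int (isolated_count S)) + int level_bound * (1 + int (isolated_count T))"
    using isolated_count_swap[OF assms(1)] by (simp flip: distrib_left of_nat_add)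
  ultimately have "int (hom_weight P) + int (hom_weight Q) < int (hom_weight S) + int (hom_weight T)"
    using assms(2-5) by (simp add: int_hom_weight)
  then show ?thesis by simp
qed

section \<open>Moves and irreducible monomials\<close>

definition moves :: "(('v \<Rightarrow> bool) monom \<times> ('v \<Rightarrow> bool) monom) set" where
  "moves = {(m, n). m \<in> monoms X \<and> n \<in> monoms X \<and> monom_deg m \<le> 2 \<and> monom_deg n \<le> 2 \<and>
     (\<not> has_isolated_vertex G \<longrightarrow> monom_deg m = 2 \<and> monom_deg n = 2) \<and> squarefree_monom m \<and>
     image_monom G m = image_monom G n \<and> weight hom_weight n < weight hom_weight m}"

lemma finite_moves: "finite moves"
proof (rule finite_subset)
  show "moves \<subseteq> {m \<in> monoms X. monom_deg m \<le> 2} \<times> {m \<in> monoms X. monom_deg m \<le> 2}"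
    by (auto simp: moves_def)
qed (simp add: finite_monoms_deg_le[OF finite_X])

definition standard :: "('v \<Rightarrow> bool) monom \<Rightarrow> bool" where
  "standard n \<longleftrightarrow> n \<in> monoms X \<and> \<not> (\<exists>(a, b)\<in>moves. \<exists>k. n = a + k)"

lemma standard_keys: "standard n \<Longrightarrow> \<phi> \<in> Poly_Mapping.keys n \<Longrightarrow> \<phi> \<in> X"
  by (auto simp: standard_def monoms_def)

lemma standardD: "standard n \<Longrightarrow> (a, b) \<in> moves \<Longrightarrow> n \<noteq> a + k"
  by (auto simp: standard_def)

text \<open>The exchange would be a quadratic move whose leading monomial divides
  \<open>n\<close>.\<close>

lemma standard_no_swap:
  assumes "standard n" "S \<in> Poly_Mapping.keys n" "T \<in> Poly_Mapping.keys n" "P \<in> X" "Q \<in> X"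
    and "swapped S T P Q" "level P < level S" "level P < level T"
  shows False
proof -
  let ?m = "Poly_Mapping.single S 1 + Poly_Mapping.single T (1::nat)"
  let ?m' = "Poly_Mapping.single P 1 + Poly_Mapping.single Q (1::nat)"
  have X: "S \<in> X" "T \<in> X" using assms(1-3) standard_keys by auto
  \<comment> \<open>Distinctness makes \<open>?m\<close> squarefree and a divisor of
    \<open>n\<close>. Exchanging a set with itself changes nothing, so \<open>P\<close> could not
    have a lower level.\<close>
  have "S \<noteq> T"
  proof
    assume "S = T"
    then have "level P = level S"
      using assms(6) by (auto simp: level_def swapped_def intro: sum.cong)
    then show False using assms(7) by simp
  qed
  then have "squarefree_monom ?m"
    by (auto simp: squarefree_monom_def lookup_add lookup_single when_def)
  then have "(?m, ?m') \<in> moves"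
    using X assms(4-8) hom_monom_swap hom_weight_swap
    by (simp add: moves_def single_in_monoms monom_deg_eq_weight image_monom_single[unfolded One_nat_def])
  moreover have "n = ?m + (n - ?m)"
    using assms(2,3) \<open>S \<noteq> T\<close>
    by (intro poly_mapping_eqI) (auto simp: lookup_add lookup_minus lookup_single when_def in_keys_iff)
  ultimately show False using standardD[OF assms(1)] by blast
qed

lemma single_move:
  assumes "standard n" "\<phi> \<in> Poly_Mapping.keys n"
  shows "(Poly_Mapping.single \<phi> 1, m) \<notin> moves"
proof
  assume "(Poly_Mapping.single \<phi> 1, m) \<in> moves"
  moreover have "n = Poly_Mapping.single \<phi> 1 + (n - Poly_Mapping.single \<phi> 1)"
    using assms(2)
    by (intro poly_mapping_eqI) (auto simp: lookup_add lookup_minus lookup_single when_def in_keys_iff)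
  ultimately show False using standardD[OF assms(1)] by blast
qed

lemma squarefree_single: "squarefree_monom (Poly_Mapping.single x 1)"
  by (simp add: squarefree_monom_def lookup_single when_def)

lemma has_isolated_vertexI: "x \<in> isolated \<Longrightarrow> has_isolated_vertex G"
  by (auto simp: isolated_def has_isolated_vertex_def)

text \<open>The image only sees edges, so dropping all isolated vertices from \<phi> keeps it. The
  weight decreases because even one of them costs \<open>level_bound\<close>, which no squared level
  compensates. This is a linear move.\<close>

lemma standard_isolated:
  assumes "standard n" "\<phi> \<in> Poly_Mapping.keys n" "x \<in> isolated"
  shows "\<not> \<phi> x"
proof
  assume "\<phi> x"
  define \<psi> where "\<psi> = (\<lambda>y\<in>verts G. \<phi> y \<and> y \<notin> isolated)"
  have \<phi>: "\<phi> \<in> X" using assms standard_keys by blast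
  have le: "\<psi> y \<Longrightarrow> \<phi> y" if "y \<in> verts G" for y using that by (simp add: \<psi>_def)
  have \<psi>: "\<psi> \<in> X"
    unfolding Hom_Lambda_iff
  proof (intro conjI allI impI notI)
    show "\<psi> \<in> extensional (verts G)" by (simp add: \<psi>_def)
    fix u w assume uw: "{u, w} \<in> edges G" "\<psi> u \<and> \<psi> w"
    then have "u \<in> verts G" "w \<in> verts G" using edge_subset by auto
    then show False using uw not_both[OF \<phi> uw(1)] le by blast
  qed
  have "hom_monom G \<phi> = hom_monom G \<psi>"
    unfolding hom_monom_def
  proof (intro sum.cong refl)
    fix e assume e: "e \<in> edges G"
    have "restrict \<phi> e = restrict \<psi> e"
      using edge_subset[OF e] e by (auto simp: \<psi>_def isolated_def restrict_def)
    then show "Poly_Mapping.single (e, restrict \<phi> e) 1 = Poly_Mapping.single (e, restrict \<psi> e) (1::nat)"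
      by simp
  qed
  moreover have "hom_weight \<psi> < hom_weight \<phi>"
  proof -
    have "isolated_count \<psi> = 0"
      unfolding isolated_count_def by (rule sum.neutral) (auto simp: \<psi>_def isolated_def)
    then have "hom_weight \<psi> \<le> level_bound" by (simp add: hom_weight_def)
    also have "level_bound < level_bound * 2 - nat ((level \<phi>)\<^sup>2)"
      using level_bound[OF \<phi>] by linarith
    also have "1 \<le> isolated_count \<phi>"
      unfolding isolated_count_def
      using member_le_sum[of x isolated "\<lambda>x. of_bool (\<phi> x) :: nat"] \<open>\<phi> x\<close> assms(3) finite_verts
      by (simp add: isolated_def)
    then have "level_bound * 2 - nat ((level \<phi>)\<^sup>2) \<le> hom_weight \<phi>"
      unfolding hom_weight_def by (intro diff_le_mono mult_le_mono) auto
    finally show ?thesis .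
  qed
  ultimately have "(Poly_Mapping.single \<phi> 1, Poly_Mapping.single \<psi> 1) \<in> moves"
    using \<phi> \<psi> has_isolated_vertexI[OF assms(3)] squarefree_single[of \<phi>]
    by (simp add: moves_def single_in_monoms monom_deg_eq_weight image_monom_single[unfolded One_nat_def])
  then show False using single_move[OF assms(1,2)] by blast
qed

text \<open>Without edges every variable maps to 1 and \<open>v\<close> is isolated, so a variable
  minus 1 gives a linear move, oriented by positivity of the weight.\<close>

lemma standard_edgeless:
  assumes "standard n" "edges G = {}"
  shows "n = 0"
proof (rule ccontr)
  assume "n \<noteq> 0"
  then obtain \<phi> where \<phi>: "\<phi> \<in> Poly_Mapping.keys n" by (metis ex_in_conv keys_eq_empty)
  have X: "\<phi> \<in> X" using assms \<phi> standard_keys by blast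
  have "has_isolated_vertex G" using apex assms(2) by (auto simp: has_isolated_vertex_def)
  moreover have "hom_monom G \<phi> = 0" by (simp add: hom_monom_def assms(2))
  ultimately have "(Poly_Mapping.single \<phi> 1, 0) \<in> moves"
    using X hom_weight_pos[OF X] squarefree_single[of \<phi>]
    by (simp add: moves_def single_in_monoms monom_deg_eq_weight image_monom_single[unfolded One_nat_def])
  then show False using single_move[OF assms(1) \<phi>] by blast
qed

text \<open>Independent sets that agree at \<open>v\<close> form a distributive lattice under meet and join taken as
  intersection on \<open>A\<close> and union on \<open>B\<close>, and vice versa.\<close>

lemma standard_chain:
  assumes "standard n" "S \<in> Poly_Mapping.keys n" "T \<in> Poly_Mapping.keys n"
    and "S v = T v" "level S \<le> level T"
  shows "\<forall>a\<in>A. S a \<longrightarrow> T a" "\<forall>b\<in>B. T b \<longrightarrow> S b"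
proof -
  \<comment> \<open>\<open>P\<close> is the meet and \<open>Q\<close> the join; both agree with
    \<open>S\<close> and \<open>T\<close> at \<open>v\<close>.\<close>
  define P where "P = (\<lambda>x\<in>verts G. if x \<in> A then S x \<and> T x else S x \<or> T x)"
  define Q where "Q = (\<lambda>x\<in>verts G. if x \<in> A then S x \<or> T x else S x \<and> T x)"
  have X: "S \<in> X" "T \<in> X" using assms(1-3) standard_keys by auto
  have A: "a \<in> verts G" "a \<noteq> v" "a \<notin> B" if "a \<in> A" for a using that sides by auto
  have B: "b \<in> verts G" "b \<noteq> v" "b \<notin> A" if "b \<in> B" for b using that sides by auto
  have v: "v \<notin> A" "v \<notin> B" using sides by auto
  have PQ: "P v = S v" "Q v = S v" using apex v assms(4) by (auto simp: P_def Q_def)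
  have PX: "P \<in> X"
  proof (rule in_XI)
    show "P \<in> extensional (verts G)" by (simp add: P_def)
    show False if "a \<in> A" "b \<in> B" "{a, b} \<in> edges G" "P a" "P b" for a b
      using that A B not_both[OF X(1) that(3)] not_both[OF X(2) that(3)] by (auto simp: P_def)
    show False if "{v, x} \<in> edges G" "P v" "P x" for x
      using that edge_subset[OF that(1)] PQ assms(4) not_both[OF X(1) that(1)] not_both[OF X(2) that(1)]
      by (auto simp: P_def split: if_splits)
  qed
  have QX: "Q \<in> X"
  proof (rule in_XI)
    show "Q \<in> extensional (verts G)" by (simp add: Q_def)
    show False if "a \<in> A" "b \<in> B" "{a, b} \<in> edges G" "Q a" "Q b" for a b
      using that A B not_both[OF X(1) that(3)] not_both[OF X(2) that(3)] by (auto simp: Q_def)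
    show False if "{v, x} \<in> edges G" "Q v" "Q x" for x
      using that edge_subset[OF that(1)] PQ assms(4) not_both[OF X(1) that(1)] not_both[OF X(2) that(1)]
      by (auto simp: Q_def split: if_splits)
  qed
  have "swapped S T P Q" by (auto simp: swapped_def P_def Q_def)
  \<comment> \<open>A meet different from \<open>S\<close> would have level below both
    \<open>S\<close> and \<open>T\<close>, making the exchange a move.\<close>
  have eq: "P x = S x" if x: "x \<in> verts G" for x
  proof (rule ccontr)
    assume "P x \<noteq> S x"
    then have "level P < level S"
      using PQ A B x by (intro level_less[of P S x]) (auto simp: P_def)
    then show False
      using standard_no_swap[OF assms(1-3) PX QX \<open>swapped S T P Q\<close>] assms(5) by simp
  qed
  show "\<forall>a\<in>A. S a \<longrightarrow> T a" using eq A by (fastforce simp: P_def)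
  show "\<forall>b\<in>B. T b \<longrightarrow> S b" using eq B by (fastforce simp: P_def)
qed

section \<open>Vertex counts of irreducible monomials\<close>

text \<open>Multiplicities are included. The flag \<open>c\<close> separates the sets containing
  \<open>v\<close> from those avoiding it, the two chains of a standard monomial.\<close>

definition count :: "bool \<Rightarrow> ('v \<Rightarrow> bool) monom \<Rightarrow> 'v \<Rightarrow> nat" where
  "count c n x = weight (\<lambda>\<phi>. of_bool (\<phi> v = c \<and> \<phi> x)) n"

definition total :: "bool \<Rightarrow> ('v \<Rightarrow> bool) monom \<Rightarrow> nat" where
  "total c n = weight (\<lambda>\<phi>. of_bool (\<phi> v = c)) n"

lemma count_le_total: "count c n x \<le> total c n"
  unfolding count_def total_def by (rule weight_mono) auto

lemma count_pos_iff: "0 < count c n x \<longleftrightarrow> (\<exists>\<phi>\<in>Poly_Mapping.keys n. \<phi> v = c \<and> \<phi> x)"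
  unfolding count_def weight_pos_iff by auto

lemma count_less_total_iff:
  "count c n x < total c n \<longleftrightarrow> (\<exists>\<phi>\<in>Poly_Mapping.keys n. \<phi> v = c \<and> \<not> \<phi> x)"
proof -
  have "total c n = count c n x + weight (\<lambda>\<phi>. of_bool (\<phi> v = c \<and> \<not> \<phi> x)) n"
    unfolding count_def total_def weight_add_fun[symmetric] by (rule weight_cong) auto
  moreover have "0 < weight (\<lambda>\<phi>. of_bool (\<phi> v = c \<and> \<not> \<phi> x)) n \<longleftrightarrow>
      (\<exists>\<phi>\<in>Poly_Mapping.keys n. \<phi> v = c \<and> \<not> \<phi> x)"
    unfolding weight_pos_iff by auto
  ultimately show ?thesis by linarith
qed

text \<open>An independent set contains at most one endpoint, so each set contributes at most once.
  \<open>count_edge_ge\<close> recognises when this bound is tight.\<close>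

lemma count_edge_le:
  assumes "n \<in> monoms X" "{x, y} \<in> edges G"
  shows "count c n x + count c n y \<le> total c n"
  unfolding count_def total_def weight_add_fun[symmetric]
  using assms not_both by (intro weight_mono) (auto simp: monoms_def of_bool_def)

lemma count_edge_ge:
  assumes "\<And>\<phi>. \<phi> \<in> Poly_Mapping.keys n \<Longrightarrow> \<phi> v = c \<Longrightarrow> \<phi> x \<or> \<phi> y"
  shows "total c n \<le> count c n x + count c n y"
  unfolding count_def total_def weight_add_fun[symmetric]
  using assms by (intro weight_mono) (auto simp: of_bool_def)

lemma count_add: "count True n x + count False n x = weight (\<lambda>\<phi>. of_bool (\<phi> x)) n"
  unfolding count_def weight_add_fun[symmetric] by (rule weight_cong) auto

text \<open>A vertex on an edge is seen by the image through that edge, and isolated vertices lie in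
  no set that occurs. The vertex \<open>v\<close> gives the size of the part containing it, and any
  edge gives the degree. How a count splits between the two parts is left to
  \<open>standard_counts_le\<close>.\<close>

lemma same_fibre_counts:
  assumes "standard n" "standard n'" "image_monom G n = image_monom G n'" "edges G \<noteq> {}"
  shows "x \<in> verts G \<Longrightarrow> count True n x + count False n x = count True n' x + count False n' x"
    and "total c n = total c n'"
    and "monom_deg n = monom_deg n'"
proof -
  have single: "weight (\<lambda>\<phi>. of_bool (\<phi> x)) n = weight (\<lambda>\<phi>. of_bool (\<phi> x)) n'" if x: "x \<in> verts G" for x
  proof (cases "x \<in> isolated")
    case True
    then have "weight (\<lambda>\<phi>. of_bool (\<phi> x)) m = weight (\<lambda>\<phi>. 0) m" if "standard m" for m
      using standard_isolated[OF that _ True] by (intro weight_cong) auto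
    then show ?thesis using assms by (simp add: weight_def)
  next
    case False
    then obtain e where e: "e \<in> edges G" "x \<in> e" using x by (auto simp: isolated_def)
    then show ?thesis
      using weight_edge_cong[OF e(1) assms(3), of "\<lambda>\<chi>. of_bool (\<chi> x)"] by simp
  qed
  then show "x \<in> verts G \<Longrightarrow> count True n x + count False n x = count True n' x + count False n' x"
    by (simp add: count_add)
  obtain e where "e \<in> edges G" using assms(4) by blast
  then show deg: "monom_deg n = monom_deg n'"
    using weight_edge_cong[OF _ assms(3), of e "\<lambda>_. 1"] by (simp add: monom_deg_eq_weight)
  have true: "total True n = total True n'"
    using single[OF apex] by (simp add: total_def)
  have "total True m + total False m = monom_deg m" for m
    unfolding total_def monom_deg_eq_weight weight_add_fun[symmetric] by (rule weight_cong) auto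
  from this[of n] this[of n'] have "total False n = total False n'" using deg true by linarith
  then show "total c n = total c n'" using true by (cases c) simp_all
qed

text \<open>If \<open>n\<close> were not below \<open>n'\<close>, let \<open>D\<close> be the set of offending vertices. Among the pairs of
  independent sets \<open>S\<close> avoiding \<open>v\<close> and \<open>T\<close> containing \<open>v\<close> that occur in \<open>n\<close> and admit an
  exchange at some vertex of \<open>D\<close>, choose one maximising the difference of levels. Then every
  constraint blocking the simultaneous exchange at all such vertices is tight for \<open>n\<close>, hence
  only involves vertices of \<open>D\<close>, and the exchange lowers the weight.\<close>

lemma standard_counts_le:
  assumes n: "standard n" and n': "standard n'"
    and fibre: "image_monom G n = image_monom G n'" and ne: "edges G \<noteq> {}"
  shows "\<forall>a\<in>A. count True n a \<le> count True n' a" "\<forall>b\<in>B. count True n' b \<le> count True n b"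
proof -
  define D where "D x \<longleftrightarrow> x \<in> A \<and> count True n' x < count True n x \<or>
    x \<in> B \<and> count True n x < count True n' x" for x
  \<comment> \<open>At these vertices, giving \<open>T\<close> the membership of \<open>S\<close>
    lowers it: it loses a vertex of \<open>A\<close> or gains one of \<open>B\<close>.\<close>
  define C where "C S T x \<longleftrightarrow> D x \<and> (x \<in> A \<and> T x \<and> \<not> S x \<or> x \<in> B \<and> S x \<and> \<not> T x)" for S T x
  define R where "R = {(S, T). S \<in> Poly_Mapping.keys n \<and> T \<in> Poly_Mapping.keys n \<and>
    \<not> S v \<and> T v \<and> (\<exists>x. C S T x)}"
  have A: "a \<in> verts G" "a \<noteq> v" "a \<notin> B" if "a \<in> A" for a using that sides by auto
  have B: "b \<in> verts G" "b \<noteq> v" "b \<notin> A" if "b \<in> B" for b using that sides by auto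
  note cnt = same_fibre_counts(1)[OF n n' fibre ne]
  note tot = same_fibre_counts(2)[OF n n' fibre ne]
  have nX': "n' \<in> monoms X" using n' by (simp add: standard_def)
  have empty: "\<not> D x" for x
  proof
    assume "D x"
    \<comment> \<open>The sum of both counts at \<open>x\<close> is fixed, so a discrepancy in one
      part is an opposite one in the other. Hence neither count is extreme in the direction that
      would rule out a suitable \<open>S\<close> or \<open>T\<close>.\<close>
    have "\<exists>S\<in>Poly_Mapping.keys n. \<exists>T\<in>Poly_Mapping.keys n. \<not> S v \<and> T v \<and> C S T x"
    proof (cases "x \<in> A")
      case True
      then have lt: "count True n' x < count True n x" using \<open>D x\<close> A by (auto simp: D_def)
      then have "count False n x < total False n"
        using cnt[OF A(1)[OF True]] tot[of False] count_le_total[of False n' x] by linarith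
      then have "\<exists>S\<in>Poly_Mapping.keys n. \<not> S v \<and> \<not> S x" by (simp add: count_less_total_iff)
      moreover have "\<exists>T\<in>Poly_Mapping.keys n. T v \<and> T x" using lt count_pos_iff[of True n x] by auto
      ultimately show ?thesis using True \<open>D x\<close> by (auto simp: C_def)
    next
      case False
      then have x: "x \<in> B" and lt: "count True n x < count True n' x" using \<open>D x\<close> by (auto simp: D_def)
      then have "0 < count False n x" using cnt[OF B(1)[OF x]] by linarith
      then have "\<exists>S\<in>Poly_Mapping.keys n. \<not> S v \<and> S x" by (simp add: count_pos_iff)
      moreover have "count True n x < total True n"
        using lt tot[of True] count_le_total[of True n' x] by linarith
      then have "\<exists>T\<in>Poly_Mapping.keys n. T v \<and> \<not> T x" by (simp add: count_less_total_iff)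
      ultimately show ?thesis using x \<open>D x\<close> by (auto simp: C_def)
    qed
    then have "R \<noteq> {}" by (auto simp: R_def)
    moreover have "finite R"
      by (rule finite_subset[of _ "Poly_Mapping.keys n \<times> Poly_Mapping.keys n"]) (auto simp: R_def)
    moreover define d where "d p = level (fst p) - level (snd p)" for p
    ultimately have "Max (d ` R) \<in> d ` R" and le_Max: "\<And>p. p \<in> R \<Longrightarrow> d p \<le> Max (d ` R)" by auto
    then obtain S T where ST: "(S, T) \<in> R" and "d (S, T) = Max (d ` R)" by auto
    then have max: "level S' - level T' \<le> level S - level T" if "(S', T') \<in> R" for S' T'
      using le_Max[OF that] by (simp add: d_def)
    have S: "S \<in> Poly_Mapping.keys n" "S \<in> X" "\<not> S v" and T: "T \<in> Poly_Mapping.keys n" "T \<in> X" "T v"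
      using ST standard_keys[OF n] by (auto simp: R_def)
    \<comment> \<open>A set avoiding \<open>v\<close> contains \<open>b\<close> if it is not above
      \<open>S\<close>, by the chain property, and \<open>a\<close> if it is above, by maximality.
      So the edge is tight for \<open>n\<close> in this part, and the deficit at \<open>a\<close>
      forces a surplus at \<open>b\<close>. As the sums are fixed, \<open>b\<close> offends in the
      other part.\<close>
    have closed_A: "C S T b" if "a \<in> A" "b \<in> B" "{a, b} \<in> edges G" "C S T a" "S b" for a b
    proof -
      have a: "T a" "\<not> S a" "count True n' a < count True n a" "D a"
        using that(1,4) A[OF that(1)] by (auto simp: C_def D_def)
      have "\<phi> a \<or> \<phi> b" if \<phi>: "\<phi> \<in> Poly_Mapping.keys n" "\<phi> v = False" for \<phi>
      proof (cases "level \<phi> \<le> level S")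
        case True
        then show ?thesis using standard_chain(2)[OF n \<phi>(1) S(1)] \<phi>(2) S(3) \<open>S b\<close> \<open>b \<in> B\<close> by auto
      next
        case False
        then have "(\<phi>, T) \<notin> R" using max by fastforce
        then show ?thesis using \<phi> T a \<open>a \<in> A\<close> by (auto simp: R_def C_def)
      qed
      then have "total False n \<le> count False n a + count False n b" by (rule count_edge_ge)
      also have "total False n = total False n'" by (rule tot)
      finally have "count False n' a + count False n' b \<le> count False n a + count False n b"
        using count_edge_le[OF nX' that(3), of False] by linarith
      then have "count True n b < count True n' b"
        using cnt[OF A(1)[OF that(1)]] cnt[OF B(1)[OF that(2)]] a(3) by linarith
      moreover have "\<not> T b" using not_both[OF T(2) that(3)] a(1) by blast
      ultimately show ?thesis using that by (auto simp: C_def D_def)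
    qed
    \<comment> \<open>Dual argument among the sets containing \<open>v\<close>, where the counts
      that define \<open>D\<close> are compared directly.\<close>
    have closed_B: "C S T a" if "a \<in> A" "b \<in> B" "{a, b} \<in> edges G" "C S T b" "T a" for a b
    proof -
      have b: "S b" "\<not> T b" "count True n b < count True n' b" "D b"
        using that(2,4) B[OF that(2)] by (auto simp: C_def D_def)
      have "\<phi> a \<or> \<phi> b" if \<phi>: "\<phi> \<in> Poly_Mapping.keys n" "\<phi> v = True" for \<phi>
      proof (cases "level T \<le> level \<phi>")
        case True
        then show ?thesis using standard_chain(1)[OF n T(1) \<phi>(1)] \<phi>(2) T(3) \<open>T a\<close> \<open>a \<in> A\<close> by auto
      next
        case False
        then have "(S, \<phi>) \<notin> R" using max by fastforce
        then show ?thesis using \<phi> S b \<open>b \<in> B\<close> by (auto simp: R_def C_def)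
      qed
      then have "total True n \<le> count True n a + count True n b" by (rule count_edge_ge)
      also have "total True n = total True n'" by (rule tot)
      finally have "count True n' a + count True n' b \<le> count True n a + count True n b"
        using count_edge_le[OF nX' that(3), of True] by linarith
      then have "count True n' a < count True n a" using b(3) by linarith
      moreover have "\<not> S a" using not_both[OF S(2) that(3)] b(1) by blast
      ultimately show ?thesis using that by (auto simp: C_def D_def)
    qed
    define P where "P = (\<lambda>x\<in>verts G. if C S T x then S x else T x)"
    define Q where "Q = (\<lambda>x\<in>verts G. if C S T x then T x else S x)"
    have Cv: "\<not> C S T v" using sides by (auto simp: C_def)
    have PQv: "P v" "\<not> Q v" using Cv S T apex by (auto simp: P_def Q_def)
    have PX: "P \<in> X"
    proof (rule in_XI)
      show "P \<in> extensional (verts G)" by (simp add: P_def)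
      show False if "a \<in> A" "b \<in> B" "{a, b} \<in> edges G" "P a" "P b" for a b
      proof -
        \<comment> \<open>On \<open>A\<close> the set \<open>P\<close> only loses vertices of
          \<open>T\<close>, so \<open>a\<close> is not exchanged, and by \<open>closed_B\<close>
          neither is \<open>b\<close>.\<close>
        have Ca: "\<not> C S T a" and Ta: "T a"
          using that A[OF that(1)] by (auto simp: P_def C_def split: if_splits)
        then have "\<not> C S T b" using closed_B that by blast
        then have "T b" using that(5) B(1)[OF that(2)] by (simp add: P_def)
        then show False using not_both[OF T(2) that(3) Ta] by blast
      qed
      show False if e: "{v, x} \<in> edges G" and "P v" "P x" for x
      proof (cases "C S T x")
        \<comment> \<open>An exchanged \<open>x\<close> in \<open>P\<close> lies in \<open>B\<close>
          and is used by \<open>n'\<close> together with \<open>v\<close>, so it cannot be a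
          neighbour of \<open>v\<close>.\<close>
        case True
        have x: "x \<in> verts G" using edge_subset[OF e] by auto
        have "x \<in> B" "count True n x < count True n' x"
          using True A B \<open>P x\<close> x by (auto simp: C_def D_def P_def)
        then obtain \<phi> where "\<phi> \<in> Poly_Mapping.keys n'" "\<phi> v" "\<phi> x" using count_pos_iff[of True n' x] by auto
        then show False using not_both[OF standard_keys[OF n'] e] by blast
      next
        case False
        then show ?thesis
          using \<open>P x\<close> edge_subset[OF e] not_both[OF T(2) e T(3)] by (simp add: P_def)
      qed
    qed
    have QX: "Q \<in> X"
    proof (rule in_XI)
      show "Q \<in> extensional (verts G)" by (simp add: Q_def)
      show False if "a \<in> A" "b \<in> B" "{a, b} \<in> edges G" "Q a" "Q b" for a b
      proof -
        \<comment> \<open>On \<open>B\<close> the set \<open>Q\<close> only loses vertices of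
          \<open>S\<close>, so \<open>b\<close> is not exchanged, and by \<open>closed_A\<close>
          neither is \<open>a\<close>.\<close>
        have Cb: "\<not> C S T b" and Sb: "S b"
          using that B[OF that(2)] by (auto simp: Q_def C_def split: if_splits)
        then have "\<not> C S T a" using closed_A that by blast
        then have "S a" using that(4) A(1)[OF that(1)] by (simp add: Q_def)
        then show False using not_both[OF S(2) that(3) _ Sb] by blast
      qed
      show False if "{v, x} \<in> edges G" "Q v" "Q x" for x using that PQv by simp
    qed
    obtain y where y: "C S T y" using ST by (auto simp: R_def)
    then have "y \<in> verts G" "P y \<noteq> T y" using A B by (auto simp: C_def P_def)
    then have "level P < level T"
      using PQv T A B by (intro level_less[of P T y]) (auto simp: P_def C_def split: if_splits)
    moreover have "level T < level S" using S T by (intro level_less_apex)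
    moreover have "swapped S T P Q" by (auto simp: swapped_def P_def Q_def)
    ultimately show False
      using standard_no_swap[OF n S(1) T(1) PX QX] by simp
  qed
  then show "\<forall>a\<in>A. count True n a \<le> count True n' a" "\<forall>b\<in>B. count True n' b \<le> count True n b"
    by (auto simp: D_def not_less)
qed

section \<open>Uniqueness of the irreducible monomial in a fibre\<close>

text \<open>The set of least level is the bottom of its chain: it contains a vertex of
  \<open>A\<close> only if all sets do, and a vertex of \<open>B\<close> as soon as one does. So the
  counts determine it.\<close>

lemma standard_least:
  assumes "standard n" "0 < total c n"
  obtains \<phi> where "\<phi> \<in> Poly_Mapping.keys n" "\<phi> v = c"
    "\<And>a. a \<in> A \<Longrightarrow> \<phi> a \<longleftrightarrow> \<not> count c n a < total c n"
    "\<And>b. b \<in> B \<Longrightarrow> \<phi> b \<longleftrightarrow> 0 < count c n b"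
proof -
  let ?K = "{\<phi> \<in> Poly_Mapping.keys n. \<phi> v = c}"
  have "?K \<noteq> {}" using assms(2) by (auto simp: total_def weight_pos_iff)
  then have "Min (level ` ?K) \<in> level ` ?K" by (intro Min_in) auto
  then obtain \<phi> where \<phi>: "\<phi> \<in> Poly_Mapping.keys n" "\<phi> v = c" and "level \<phi> = Min (level ` ?K)" by auto
  then have min: "level \<phi> \<le> level \<psi>" if "\<psi> \<in> Poly_Mapping.keys n" "\<psi> v = c" for \<psi>
    using that by (simp add: Min_le)
  note chain = standard_chain[OF assms(1) \<phi>(1)]
  show thesis
  proof (rule that[OF \<phi>])
    show "\<phi> a \<longleftrightarrow> \<not> count c n a < total c n" if "a \<in> A" for a
      unfolding count_less_total_iff using chain(1) min \<phi> that by blast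
    show "\<phi> b \<longleftrightarrow> 0 < count c n b" if "b \<in> B" for b
      unfolding count_pos_iff using chain(2) min \<phi> that by blast
  qed
qed

text \<open>Equal counts give equal bottom elements, so a nonempty part would yield a set common to
  both supports. With disjoint supports both monomials must be 1.\<close>

lemma standard_unique:
  assumes n: "standard n" and n': "standard n'" and fibre: "image_monom G n = image_monom G n'"
    and disjoint: "Poly_Mapping.keys n \<inter> Poly_Mapping.keys n' = {}"
  shows "n = n'"
proof (cases "edges G = {}")
  case True
  then show ?thesis using standard_edgeless[OF n] standard_edgeless[OF n'] by simp
next
  case ne: False
  note le = standard_counts_le[OF n n' fibre ne] standard_counts_le[OF n' n fibre[symmetric] ne]
  note tot = same_fibre_counts(2)[OF n n' fibre ne]
  have zero: "m = 0" if "total True m = 0" "total False m = 0" for m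
    using that weight_pos_iff[of "\<lambda>\<phi>. of_bool (\<phi> v = True)" m] weight_pos_iff[of "\<lambda>\<phi>. of_bool (\<phi> v = False)" m]
    by (auto simp: total_def simp flip: keys_eq_empty)
  \<comment> \<open>The comparison applies in both directions; the fixed sums then settle the sets
    avoiding \<open>v\<close>.\<close>
  have "count True n x = count True n' x" if "x \<in> A \<union> B" for x
    using le that by (auto intro: antisym)
  moreover have "x \<in> verts G" if "x \<in> A \<union> B" for x using that sides by auto
  ultimately have cnt: "count c n x = count c n' x" if "x \<in> A \<union> B" for c x
    using same_fibre_counts(1)[OF n n' fibre ne, of x] that by (cases c) auto
  have "\<not> 0 < total c n" for c
  proof
    assume pos: "0 < total c n"
    then obtain \<phi> where \<phi>: "\<phi> \<in> Poly_Mapping.keys n" "\<phi> v = c"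
      "\<And>a. a \<in> A \<Longrightarrow> \<phi> a \<longleftrightarrow> \<not> count c n a < total c n" "\<And>b. b \<in> B \<Longrightarrow> \<phi> b \<longleftrightarrow> 0 < count c n b"
      using standard_least[OF n] by blast
    obtain \<psi> where \<psi>: "\<psi> \<in> Poly_Mapping.keys n'" "\<psi> v = c"
      "\<And>a. a \<in> A \<Longrightarrow> \<psi> a \<longleftrightarrow> \<not> count c n' a < total c n'" "\<And>b. b \<in> B \<Longrightarrow> \<psi> b \<longleftrightarrow> 0 < count c n' b"
      using standard_least[OF n', of c] pos tot[of c] by auto
    have "\<phi> x = \<psi> x" if "x \<in> verts G" for x
    proof -
      from that sides consider "x = v" | "x \<in> A" | "x \<in> B" by blast
      then show ?thesis using \<phi> \<psi> cnt tot[of c] by cases auto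
    qed
    then have "\<phi> = \<psi>" using X_eqI standard_keys n n' \<phi>(1) \<psi>(1) by blast
    then show False using \<phi>(1) \<psi>(1) disjoint by blast
  qed
  then have "total c n = 0" "total c n' = 0" for c using tot[of c] by auto
  then show ?thesis using zero[of n] zero[of n'] by simp
qed

text \<open>Of two distinct monomials in a fibre with disjoint supports, one is not standard by
  \<open>standard_unique\<close>. This is the divisibility asked for by
  \<open>groebner_basis_binomials\<close>.\<close>

lemma quadratic_squarefree_groebner_basis:
  "\<exists>r (B :: ('v \<Rightarrow> bool, 'k::field) mpoly set).
    monomial_order X r \<and> groebner_basis X r (hom_ideal G Lambda_graph) B \<and>
    quadratic_basis G B \<and> (\<forall>g\<in>B. squarefree_monom (lead_monom r g))"
proof -
  let ?b = "\<lambda>(m, n). monom_poly m - monom_poly n :: ('v \<Rightarrow> bool, 'k) mpoly"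
  obtain e :: "('v \<Rightarrow> bool) \<Rightarrow> nat" where "inj_on e X"
    using finite_imp_inj_to_nat_seg[OF finite_X] by blast
  define r where "r = weight_order X e hom_weight"
  have ord: "monomial_order X r"
    unfolding r_def by (rule monomial_order_weight_order) fact
  have wt: "(m, n) \<in> r \<Longrightarrow> weight hom_weight m \<le> weight hom_weight n" for m n
    unfolding r_def by (rule weight_order_weight_le)
  have "groebner_basis X r (hom_ideal G Lambda_graph) (?b ` moves)"
  proof (rule groebner_basis_binomials[OF ord wt hom_ideal_eq])
    show "\<exists>(a, b)\<in>moves. (\<exists>k. m = a + k) \<or> (\<exists>k. n = a + k)"
      if "m \<in> monoms X" "n \<in> monoms X" "m \<noteq> n" "image_monom G m = image_monom G n"
        "Poly_Mapping.keys m \<inter> Poly_Mapping.keys n = {}" for m n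
    proof -
      have "\<not> standard m \<or> \<not> standard n" using standard_unique[of m n] that by blast
      then show ?thesis using that(1,2) unfolding standard_def by blast
    qed
    show "finite moves" by (rule finite_moves)
    show "m \<in> monoms X \<and> n \<in> monoms X \<and> image_monom G m = image_monom G n \<and>
        weight hom_weight n < weight hom_weight m" if "(m, n) \<in> moves" for m n
      using that by (simp add: moves_def)
    show "image_monom G (m + k) = image_monom G (n + k) \<longleftrightarrow> image_monom G m = image_monom G n" for m n k
      by (simp only: image_monom_add add_right_cancel)
  qed
  moreover have "quadratic_basis G (?b ` moves)"
  proof -
    have "monom_deg k \<le> 2 \<and> (\<not> has_isolated_vertex G \<longrightarrow> monom_deg k = 2)"
      if "(m, n) \<in> moves" "k \<in> Poly_Mapping.keys (?b (m, n))" for m n k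
    proof -
      have "m \<noteq> n" using that(1) by (auto simp: moves_def)
      then have "k = m \<or> k = n" using that(2) by (simp add: keys_binomial)
      then show ?thesis using that(1) by (auto simp: moves_def)
    qed
    then have "\<forall>g\<in>?b ` moves. \<forall>k\<in>Poly_Mapping.keys g.
        monom_deg k \<le> 2 \<and> (\<not> has_isolated_vertex G \<longrightarrow> monom_deg k = 2)" by fast
    then show ?thesis by (simp add: quadratic_basis_def)
  qed
  moreover have "squarefree_monom (lead_monom r (?b (m, n)))" if "(m, n) \<in> moves" for m n
    using that by (simp add: moves_def lead_monom_binomial[OF ord wt])
  then have "\<forall>g\<in>?b ` moves. squarefree_monom (lead_monom r g)" by fast
  ultimately show ?thesis using ord by blast
qed

end

theorem theorem8p1:
  fixes G :: "'v ugraph"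
  assumes "graph G" and "almost_bipartite G"
  shows "\<exists>r (B :: ('v \<Rightarrow> bool, 'k::field) mpoly set).
    monomial_order (Hom G Lambda_graph) r \<and>
    groebner_basis (Hom G Lambda_graph) r (hom_ideal G Lambda_graph) B \<and>
    quadratic_basis G B \<and>
    (\<forall>g\<in>B. squarefree_monom (lead_monom r g))"
proof -
  obtain v A B where v: "v \<in> verts G" and AB: "A \<union> B = verts G - {v}" "A \<inter> B = {}"
    "\<forall>e\<in>{e \<in> edges G. v \<notin> e}. \<exists>a\<in>A. \<exists>b\<in>B. e = {a, b}"
    using assms(2) by (auto simp: almost_bipartite_def bipartite_def delete_vertex_def)
  then interpret almost_bipartite_graph G v A B
    using assms(1) by unfold_locales auto
  show ?thesis using quadratic_squarefree_groebner_basis by blast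
qed

end
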